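(* Let $A\in\mathbb M_{N\times N}$, $B=(b_1,\dots,b_M)\in\mathbb M_{N\times M}$ with $1\le M\le N$, $N\ge2$, such that $\mathrm{rank}[b_i,Ab_i,\dots,A^{N-1}b_i]=N$ for each $i=1,\dots,M$, and $k:=\mathrm{rank}B<N$. Let $T$ be the minimum time function to reach the origin for $\dot x=Ax+Bu$, $u\in[-1,1]^M$, and let $$\mathcal S=\Big\{x\in\mathbb R^N:\ \exists\, r>0,\ \zeta\in\mathbb S^{N-1}\text{ with } x=\sum_{i=1}^M\int_0^r e^{A(t-r)}b_i\,\mathrm{sign}(\langle\zeta,e^{At}b_i\rangle)\,dt\ \text{ and }\ \langle\zeta,b_i\rangle=0\ \forall i=1,\dots,M\Big\}.$$ Let $\bar x\in\mathbb R^N\setminus\{0\}$. Then $T$ is non-Lipschitz at $\bar x$ if and only if $\bar x\in\mathcal S$. Moreover, $\mathcal S$ is invariant for optimal trajectories of the reversed dynamics $\dot x=-Ax-Bu$, $u\in[-1,1]^M$, $x(0)=0$, having vanishing minimized Hamiltonian.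
   Context: $T(x)$ is the infimum of times $\theta\ge0$ such that some measurable control $u:[0,\theta]\to[-1,1]^M$ steers $x$ to $0$ along $\dot y=Ay+Bu$; $\mathcal R_t=\{T\le t\}$. The minimized Hamiltonian is $h(x,\zeta)=\langle\zeta,Ax\rangle+\min_{u\in[-1,1]^M}\langle\zeta,Bu\rangle$; an optimal trajectory of the reversed dynamics from the origin has vanishing Hamiltonian if it admits an adjoint vector $\lambda(\cdot)$ (as in Pontryagin's Maximum Principle, with terminal value a proximal normal to the sublevel set $\mathcal R_t$ at the endpoint) along which $h$ vanishes. $T$ is non-Lipschitz at $x$ if there exist sequences $x_i\to x$, $y_i\to x$, $x_i\neq y_i$, with $\limsup_i |T(y_i)-T(x_i)|/\|y_i-x_i\|=+\infty$.
   Formalization: The point x̄ is additionally assumed to have T(x̄) < ∞; without this the equivalence fails at boundary points of a bounded reachable set (e.g. A = diag(1,2), B = (1,1)^T), where T blows up but x̄ is not in S. *)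

theory Defs
  imports "HOL-Analysis.Analysis"
begin

text \<open>Matrix powers and the matrix exponential (power series).\<close>

definition matpow :: "real^'n^'n \<Rightarrow> nat \<Rightarrow> real^'n^'n" where
  "matpow A k = (((**) A) ^^ k) (mat 1)"

definition mexp :: "real^'n^'n \<Rightarrow> real^'n^'n" where
  "mexp A = (\<Sum>k. (1 / fact k) *\<^sub>R matpow A k)"

text \<open>Control set [-1,1]^M.\<close>

definition ctrl_set :: "(real^'m) set" where
  "ctrl_set = {v. \<forall>i. \<bar>v $ i\<bar> \<le> 1}"

text \<open>Admissible controls on [0,theta]: measurable with values in [-1,1]^M.\<close>

definition admissible :: "real \<Rightarrow> (real \<Rightarrow> real^'m) \<Rightarrow> bool" where
  "admissible \<theta> u \<longleftrightarrow> u measurable_on {0..\<theta>} \<and> (\<forall>t\<in>{0..\<theta>}. u t \<in> ctrl_set)"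

text \<open>State at time t of y' = Ay + Bu, y(0) = x (variation of constants formula).\<close>

definition traj :: "real^'n^'n \<Rightarrow> real^'m^'n \<Rightarrow> real^'n \<Rightarrow> (real \<Rightarrow> real^'m) \<Rightarrow> real \<Rightarrow> real^'n" where
  "traj A B x u t = mexp (t *\<^sub>R A) *v x + integral {0..t} (\<lambda>s. mexp ((t - s) *\<^sub>R A) *v (B *v u s))"

text \<open>State at time t of the reversed dynamics x' = -Ax - Bu, x(0) = 0.\<close>

definition rev_traj :: "real^'n^'n \<Rightarrow> real^'m^'n \<Rightarrow> (real \<Rightarrow> real^'m) \<Rightarrow> real \<Rightarrow> real^'n" where
  "rev_traj A B u t = - integral {0..t} (\<lambda>s. mexp ((s - t) *\<^sub>R A) *v (B *v u s))"

text \<open>Minimum time function (value +\<infinity> if the origin cannot be reached).\<close>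

definition min_time :: "real^'n^'n \<Rightarrow> real^'m^'n \<Rightarrow> real^'n \<Rightarrow> ereal" where
  "min_time A B x = Inf (ereal ` {\<theta>. \<theta> \<ge> 0 \<and> (\<exists>u. admissible \<theta> u \<and> traj A B x u \<theta> = 0)})"

definition reach_set :: "real^'n^'n \<Rightarrow> real^'m^'n \<Rightarrow> real \<Rightarrow> (real^'n) set" where
  "reach_set A B t = {x. min_time A B x \<le> ereal t}"

text \<open>Minimized Hamiltonian.\<close>

definition ham :: "real^'n^'n \<Rightarrow> real^'m^'n \<Rightarrow> real^'n \<Rightarrow> real^'n \<Rightarrow> real" where
  "ham A B x \<zeta> = \<zeta> \<bullet> (A *v x) + (INF v\<in>ctrl_set. \<zeta> \<bullet> (B *v v))"

text \<open>Proximal normal to a set K at x.\<close>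

definition proximal_normal :: "(real^'n) set \<Rightarrow> real^'n \<Rightarrow> real^'n \<Rightarrow> bool" where
  "proximal_normal K x \<nu> \<longleftrightarrow> (\<exists>\<sigma>\<ge>0. \<forall>y\<in>K. \<nu> \<bullet> (y - x) \<le> \<sigma> * (norm (y - x))\<^sup>2)"

text \<open>Non-Lipschitz point of an extended-real valued function.\<close>

definition non_lipschitz_at :: "(real^'n \<Rightarrow> ereal) \<Rightarrow> real^'n \<Rightarrow> bool" where
  "non_lipschitz_at f x \<longleftrightarrow> (\<exists>xs ys. xs \<longlonglongrightarrow> x \<and> ys \<longlonglongrightarrow> x \<and> (\<forall>i. xs i \<noteq> ys i) \<and>
     limsup (\<lambda>i. \<bar>f (ys i) - f (xs i)\<bar> / ereal (norm (ys i - xs i))) = \<infinity>)"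

text \<open>The set S.\<close>

definition S_set :: "real^'n^'n \<Rightarrow> real^'m^'n \<Rightarrow> (real^'n) set" where
  "S_set A B = {x. \<exists>r>0. \<exists>\<zeta>. norm \<zeta> = 1 \<and>
      x = (\<Sum>i\<in>UNIV. integral {0..r}
             (\<lambda>t. sgn (\<zeta> \<bullet> (mexp (t *\<^sub>R A) *v column i B)) *\<^sub>R (mexp ((t - r) *\<^sub>R A) *v column i B)))
      \<and> (\<forall>i. \<zeta> \<bullet> column i B = 0)}"

end

theory Submission
  imports Defs
begin

text \<open>
  By variation of constants, \<open>x\<close> can be steered to the origin in time \<open>t\<close> iff it lies in the convex set
  \<open>R t\<close> of all integrals over \<open>[0, t]\<close> of \<open>\<Sum>j. u\<^sub>j(s) e\<^sub>j(s)\<close>, where \<open>e\<^sub>j(s)\<close> is the image of the \<open>j\<close>-th column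
  of \<open>B\<close> under \<open>exp(-sA)\<close>. The support function of \<open>R t\<close> in direction \<open>\<eta>\<close> is the integral over \<open>[0, t]\<close> of
  the speed \<open>\<Sum>j. \<bar>\<eta> \<bullet> e\<^sub>j(s)\<bar>\<close>, and by the rank condition its maximizer is unique: it is the bang-bang point
  with controls \<open>sgn (\<eta> \<bullet> e\<^sub>j(s))\<close>. The set \<open>\<S>\<close> consists of those maximizers whose direction has speed \<open>0\<close> at
  the final time. There the support function is stationary in \<open>t\<close>, so a small step in direction \<open>\<eta>\<close> costs
  a disproportionate amount of time. Conversely, from pairs of points with unbounded difference quotients
  one extracts separating directions with speed tending to \<open>0\<close>, and a limit of these exhibits the point
  as an element of \<open>\<S>\<close>. For the invariance, the minimum condition forces bang-bang controls with
  switching functions \<open>p(0) \<bullet> exp(sA) b\<^sub>j\<close>, and the Hamiltonian at time \<open>0\<close> vanishes only if \<open>p(0)\<close> is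
  orthogonal to all \<open>b\<^sub>j\<close>.
\<close>

section \<open>The matrix exponential\<close>

lemma matpow_0: "matpow A 0 = mat 1"
  and matpow_Suc: "matpow A (Suc k) = A ** matpow A k"
  by (simp_all add: matpow_def)

lemma matpow_Suc_right: "matpow A (Suc k) = matpow A k ** A"
  by (induction k) (simp_all add: matpow_0 matpow_Suc matrix_mul_assoc)

lemma matpow_scaleR: "matpow (t *\<^sub>R A) k = t ^ k *\<^sub>R matpow A k"
  by (induction k)
    (simp_all add: matpow_0 matpow_Suc scalar_matrix_assoc[symmetric] matrix_scalar_ac)

text \<open>Each multiplication by \<open>A\<close> costs at most a row sum, and the sum of all
  absolute entries dominates every row sum. The bound provides a majorant of the exponential
  series.\<close>

lemma abs_matpow_entry_le:
  "\<bar>matpow A k $ i $ j\<bar> \<le> (\<Sum>a\<in>UNIV. \<Sum>b\<in>UNIV. \<bar>A $ a $ b\<bar>) ^ k" (is "_ \<le> ?C ^ k")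
proof (induction k arbitrary: i)
  case 0
  show ?case by (simp add: matpow_0 mat_def)
next
  case (Suc k)
  have "\<bar>matpow A (Suc k) $ i $ j\<bar> \<le> (\<Sum>l\<in>UNIV. \<bar>A $ i $ l\<bar> * \<bar>matpow A k $ l $ j\<bar>)"
    by (simp add: matpow_Suc matrix_matrix_mult_def sum_abs flip: abs_mult)
  also have "\<dots> \<le> (\<Sum>l\<in>UNIV. \<bar>A $ i $ l\<bar> * ?C ^ k)"
    by (intro sum_mono mult_left_mono Suc.IH) auto
  also have "\<dots> = (\<Sum>l\<in>UNIV. \<bar>A $ i $ l\<bar>) * ?C ^ k"
    by (simp add: sum_distrib_right)
  also have "\<dots> \<le> ?C * ?C ^ k"
    by (intro mult_right_mono member_le_sum[of i UNIV "\<lambda>a. \<Sum>b\<in>UNIV. \<bar>A $ a $ b\<bar>"])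
      (auto intro!: sum_nonneg zero_le_power)
  finally show ?case by simp
qed

lemma summable_mexp: "summable (\<lambda>k. (1 / fact k) *\<^sub>R matpow A k)"
proof -
  define C where "C = (\<Sum>a\<in>UNIV. \<Sum>b\<in>UNIV. \<bar>A $ a $ b\<bar>)"
  \<comment> \<open>One factor \<open>CARD('a)\<close> counts the entries of a row, the other the
    rows.\<close>
  have le: "norm (matpow A k) \<le> real (CARD('a)) * (real (CARD('a)) * C ^ k)" for k
  proof -
    have "norm (matpow A k) \<le> (\<Sum>i\<in>UNIV. norm (matpow A k $ i))"
      by (simp add: norm_vec_def L2_set_le_sum)
    also have "\<dots> \<le> (\<Sum>i\<in>(UNIV::'a set). real (CARD('a)) * C ^ k)"
    proof (rule sum_mono)
      fix i
      have "norm (matpow A k $ i) \<le> (\<Sum>j\<in>UNIV. \<bar>matpow A k $ i $ j\<bar>)"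
        by (rule norm_le_l1_cart)
      also have "\<dots> \<le> (\<Sum>j\<in>(UNIV::'a set). C ^ k)"
        unfolding C_def by (intro sum_mono abs_matpow_entry_le)
      finally show "norm (matpow A k $ i) \<le> real (CARD('a)) * C ^ k" by simp
    qed
    finally show ?thesis by simp
  qed
  show ?thesis
  proof (rule summable_comparison_test')
    show "summable (\<lambda>k. real (CARD('a)) * real (CARD('a)) * (inverse (fact k) * C ^ k))"
      by (intro summable_mult summable_exp)
    show "norm ((1 / fact k) *\<^sub>R matpow A k)
        \<le> real (CARD('a)) * real (CARD('a)) * (inverse (fact k) * C ^ k)" for k
      using mult_left_mono[OF le[of k], of "inverse (fact k)"] by (simp add: field_simps)
  qed
qed

text \<open>Pairing with \<open>\<xi>\<close> and \<open>v\<close> turns the matrix series into a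
  scalar power series in \<open>t\<close>, which can be differentiated termwise.\<close>

lemma inner_mexp_sums:
  "(\<lambda>k. (\<xi> \<bullet> (matpow A k *v v) / fact k) * t ^ k) sums (\<xi> \<bullet> (mexp (t *\<^sub>R A) *v v))"
proof -
  have bl: "bounded_linear (\<lambda>M::real^'a^'a. \<xi> \<bullet> (M *v v))"
    by (intro linear_conv_bounded_linear[THEN iffD1] linearI)
      (simp_all add: matrix_vector_mult_add_rdistrib inner_add_right
        scaleR_matrix_vector_assoc[symmetric])
  have "(\<lambda>k. \<xi> \<bullet> (((1 / fact k) *\<^sub>R matpow (t *\<^sub>R A) k) *v v)) sums (\<xi> \<bullet> (mexp (t *\<^sub>R A) *v v))"
    unfolding mexp_def by (intro bounded_linear.sums[OF bl] summable_sums summable_mexp)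
  then show ?thesis
    by (simp add: matpow_scaleR scaleR_matrix_vector_assoc[symmetric] mult_ac)
qed

lemma mexp_0: "mexp 0 = mat 1"
proof -
  have "(\<lambda>k. (1 / fact k) *\<^sub>R matpow (0::real^'a^'a) k) = (\<lambda>k. if k = 0 then mat 1 else 0)"
  proof
    fix k show "(1 / fact k) *\<^sub>R matpow (0::real^'a^'a) k = (if k = 0 then mat 1 else 0)"
      using matpow_scaleR[of 0 0 k] by (cases k) (auto simp: matpow_0)
  qed
  then show ?thesis
    unfolding mexp_def using sums_unique[OF sums_single[of 0 "\<lambda>_. mat 1 :: real^'a^'a"]] by simp
qed

lemma mexp_commute: "A *v (mexp (t *\<^sub>R A) *v v) = mexp (t *\<^sub>R A) *v (A *v v)"
proof -
  have "\<xi> \<bullet> (A *v (mexp (t *\<^sub>R A) *v v)) = \<xi> \<bullet> (mexp (t *\<^sub>R A) *v (A *v v))" for \<xi>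
  proof -
    have "(\<lambda>k. ((transpose A *v \<xi>) \<bullet> (matpow A k *v v) / fact k) * t ^ k)
        = (\<lambda>k. (\<xi> \<bullet> (matpow A k *v (A *v v)) / fact k) * t ^ k)"
      by (simp add: dot_lmul_matrix matrix_vector_mul_assoc flip: matpow_Suc_right matpow_Suc)
    then show ?thesis
      using sums_unique2[OF inner_mexp_sums[of "transpose A *v \<xi>" A v t]] inner_mexp_sums[of \<xi> A "A *v v" t]
      by (simp add: dot_lmul_matrix)
  qed
  then show ?thesis by (metis vector_eq_rdot inner_commute)
qed

lemma inner_mexp_deriv:
  "((\<lambda>t. \<xi> \<bullet> (mexp (t *\<^sub>R A) *v v)) has_real_derivative \<xi> \<bullet> (mexp (t *\<^sub>R A) *v (A *v v))) (at t)"
proof -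
  define c where "c k = \<xi> \<bullet> (matpow A k *v v) / fact k" for k
  have "summable (\<lambda>k. c k * t ^ k)" for t
    unfolding c_def by (rule sums_summable[OF inner_mexp_sums])
  then have "((\<lambda>t. \<Sum>k. c k * t ^ k) has_real_derivative (\<Sum>k. diffs c k * t ^ k)) (at t)"
    by (rule termdiffs_strong_converges_everywhere)
  moreover have "(\<Sum>k. c k * t ^ k) = \<xi> \<bullet> (mexp (t *\<^sub>R A) *v v)" for t
    unfolding c_def by (rule sums_unique[OF inner_mexp_sums, symmetric])
  moreover have "diffs c k = \<xi> \<bullet> (matpow A k *v (A *v v)) / fact k" for k
    unfolding diffs_def c_def
    by (simp add: matrix_vector_mul_assoc flip: matpow_Suc_right)
  moreover have "(\<Sum>k. (\<xi> \<bullet> (matpow A k *v (A *v v)) / fact k) * t ^ k)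
      = \<xi> \<bullet> (mexp (t *\<^sub>R A) *v (A *v v))"
    by (rule sums_unique[OF inner_mexp_sums, symmetric])
  ultimately show ?thesis by simp
qed

lemma has_vector_derivative_innerI:
  fixes f :: "real \<Rightarrow> 'a::euclidean_space"
  assumes "\<And>\<xi>. ((\<lambda>t. \<xi> \<bullet> f t) has_real_derivative \<xi> \<bullet> f') (at t within S)"
  shows "(f has_vector_derivative f') (at t within S)"
  unfolding has_vector_derivative_def
proof (subst has_derivative_componentwise_within, intro ballI)
  fix i :: 'a
  show "((\<lambda>x. f x \<bullet> i) has_derivative (\<lambda>x. x *\<^sub>R f' \<bullet> i)) (at t within S)"
    using assms[of i] unfolding has_field_derivative_def
    by (simp add: inner_commute mult_commute_abs)
qed

lemma mexp_has_vector_derivative: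
  "((\<lambda>t. mexp (t *\<^sub>R A) *v v) has_vector_derivative mexp (t *\<^sub>R A) *v (A *v v)) (at t within S)"
  by (intro has_vector_derivative_innerI has_field_derivative_at_within[OF inner_mexp_deriv])

lemma continuous_on_mexp: "continuous_on S (\<lambda>t. mexp (t *\<^sub>R A) *v v)"
  using mexp_has_vector_derivative has_vector_derivative_continuous
  by (metis continuous_on_eq_continuous_within)

text \<open>Along an adjoint solution \<open>p\<close>, the pairing of \<open>p \<tau>\<close> with \<open>mexp ((t - \<tau>) *\<^sub>R A) *v v\<close> does not depend
  on \<open>\<tau>\<close>.\<close>

lemma adjoint_flow:
  assumes p: "\<And>t. t \<in> S \<Longrightarrow> (p has_vector_derivative transpose A *v p t) (at t within S)"
    and S: "convex S" "s \<in> S" "t \<in> S"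
  shows "p t \<bullet> v = p s \<bullet> (mexp ((t - s) *\<^sub>R A) *v v)"
proof -
  define q where "q \<tau> = p \<tau> \<bullet> (mexp ((t - \<tau>) *\<^sub>R A) *v v)" for \<tau>
  have "(q has_vector_derivative 0) (at \<tau> within S)" if "\<tau> \<in> S" for \<tau>
  proof -
    have "((\<lambda>\<tau>. mexp ((t - \<tau>) *\<^sub>R A) *v v) has_vector_derivative
        (- 1) *\<^sub>R (mexp ((t - \<tau>) *\<^sub>R A) *v (A *v v))) (at \<tau> within S)"
      by (rule vector_diff_chain_within[OF _ mexp_has_vector_derivative, unfolded o_def])
        (auto intro!: derivative_eq_intros)
    from bounded_bilinear.has_vector_derivative[OF bounded_bilinear_inner p[OF that] this]
    show ?thesis
      by (simp add: q_def[abs_def] dot_lmul_matrix mexp_commute)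
  qed
  then obtain c where "\<And>\<tau>. \<tau> \<in> S \<Longrightarrow> q \<tau> = c"
    using has_vector_derivative_zero_constant[OF S(1)] by metis
  with S have "q t = q s" by simp
  then show ?thesis by (simp add: q_def mexp_0)
qed

text \<open>As a function of time, the transposed exponential applied to \<open>\<xi>\<close> solves
  the adjoint equation, so \<open>adjoint_flow\<close> gives the group law without a Cauchy
  product.\<close>

lemma mexp_add: "mexp ((c + s) *\<^sub>R A) *v v = mexp (c *\<^sub>R A) *v (mexp (s *\<^sub>R A) *v v)"
proof -
  have "\<xi> \<bullet> (mexp ((c + s) *\<^sub>R A) *v v) = \<xi> \<bullet> (mexp (c *\<^sub>R A) *v (mexp (s *\<^sub>R A) *v v))" for \<xi>
  proof -
    define p where "p t = transpose (mexp ((c + t) *\<^sub>R A)) *v \<xi>" for t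
    have "(p has_vector_derivative transpose A *v p t) (at t)" for t
    proof (rule has_vector_derivative_innerI)
      fix w
      have "((\<lambda>t. \<xi> \<bullet> (mexp ((c + t) *\<^sub>R A) *v w)) has_real_derivative
          \<xi> \<bullet> (mexp ((c + t) *\<^sub>R A) *v (A *v w)) * 1) (at t)"
        by (rule DERIV_chain'[OF _ inner_mexp_deriv]) (auto intro!: derivative_eq_intros)
      then show "((\<lambda>t. w \<bullet> p t) has_real_derivative w \<bullet> (transpose A *v p t)) (at t)"
        by (simp add: p_def inner_commute[of w] dot_lmul_matrix)
    qed
    from adjoint_flow[of UNIV p A 0 s v, OF this] show ?thesis
      by (simp add: p_def dot_lmul_matrix)
  qed
  then show ?thesis by (metis vector_eq_rdot inner_commute)
qed

lemma mexp_uminus_cancel: "mexp (t *\<^sub>R A) *v (mexp ((- t) *\<^sub>R A) *v v) = v"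
  using mexp_add[of t "- t" A v] by (simp add: mexp_0)

section \<open>Zeros of the switching functions\<close>

text \<open>At such points the differential of \<open>f\<close> is injective, and the preimage of
  the negligible set \<open>{0}\<close> under such a map is negligible.\<close>

lemma negligible_zeros_of_nonzero_deriv:
  fixes f :: "real \<Rightarrow> real"
  assumes "\<And>t. (f has_real_derivative f' t) (at t)"
  shows "negligible {t. f t = 0 \<and> f' t \<noteq> 0}"
proof -
  have "negligible {t \<in> {t. f' t \<noteq> 0}. f t \<in> {0}}"
  proof (rule negligible_differentiable_vimage)
    show "inj ((*) (f' t))" if "t \<in> {t. f' t \<noteq> 0}" for t
      using that by (auto simp: inj_on_def)
    show "(f has_derivative (*) (f' t)) (at t within {t. f' t \<noteq> 0})" for t
      using assms[of t] by (simp add: has_field_derivative_def has_derivative_at_withinI)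
  qed simp
  then show ?thesis by (simp add: conj_commute)
qed

text \<open>At a zero of \<open>\<xi> \<bullet> (mexp (t *\<^sub>R A) *v b)\<close> some derivative of order below the dimension does not vanish,
  so the zeros are covered by finitely many negligible sets.\<close>

lemma negligible_mexp_zeros:
  fixes A :: "real^'n^'n"
  assumes kalman: "dim (span {matpow A j *v b | j. j < CARD('n)}) = CARD('n)" and "\<xi> \<noteq> 0"
  shows "negligible {t. \<xi> \<bullet> (mexp (t *\<^sub>R A) *v b) = 0}"
proof -
  define g where "g k t = \<xi> \<bullet> (mexp (t *\<^sub>R A) *v (matpow A k *v b))" for k t
  have g: "(g k has_real_derivative g (Suc k) t) (at t)" for k t
    unfolding g_def using inner_mexp_deriv[of \<xi> A "matpow A k *v b" t]
    by (simp add: matrix_vector_mul_assoc matpow_Suc)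
  have nz: "\<exists>k<CARD('n). g k t \<noteq> 0" for t
  proof (rule ccontr)
    assume "\<not> ?thesis"
    then have orth: "\<And>k. k < CARD('n) \<Longrightarrow> (transpose (mexp (t *\<^sub>R A)) *v \<xi>) \<bullet> (matpow A k *v b) = 0"
      by (auto simp: g_def dot_lmul_matrix)
    have "span {matpow A j *v b | j. j < CARD('n)} = (UNIV :: (real^'n) set)"
      using kalman dim_eq_full[of "{matpow A j *v b | j. j < CARD('n)}"] by (simp add: dim_span)
    then have "orthogonal (transpose (mexp (t *\<^sub>R A)) *v \<xi>) w" for w
      using orth by (intro orthogonal_to_span[of w "{matpow A j *v b | j. j < CARD('n)}"])
        (unfold orthogonal_def, blast+)
    then have "\<xi> \<bullet> (mexp (t *\<^sub>R A) *v w) = 0" for w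
      by (simp add: orthogonal_def dot_lmul_matrix)
    \<comment> \<open>For this \<open>w\<close> the inner product becomes
      \<open>\<xi> \<bullet> \<xi>\<close>.\<close>
    from this[of "mexp ((- t) *\<^sub>R A) *v \<xi>"] show False
      using \<open>\<xi> \<noteq> 0\<close> unfolding mexp_uminus_cancel by simp
  qed
  have "{t. g 0 t = 0} \<subseteq> (\<Union>k<CARD('n). {t. g k t = 0 \<and> g (Suc k) t \<noteq> 0})"
  proof clarify
    fix t assume g0: "g 0 t = 0"
    \<comment> \<open>The order of the first derivative that does not vanish at \<open>t\<close>. It
      is positive, so the derivative of order \<open>k - 1\<close> vanishes there while its own
      derivative does not.\<close>
    define k where "k = (LEAST k. g k t \<noteq> 0)"
    from nz[of t] obtain k' where k': "k' < CARD('n)" "g k' t \<noteq> 0" by blast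
    have k: "g k t \<noteq> 0" "k \<le> k'"
      unfolding k_def using k'(2) by (fact LeastI, fact Least_le)
    with g0 obtain l where l: "k = Suc l" by (cases k) auto
    then have "g l t = 0"
      using not_less_Least[of l "\<lambda>k. g k t \<noteq> 0"] by (auto simp: k_def)
    with k l k' show "t \<in> (\<Union>k<CARD('n). {t. g k t = 0 \<and> g (Suc k) t \<noteq> 0})"
      by force
  qed
  moreover have "negligible (\<Union>k<CARD('n). {t. g k t = 0 \<and> g (Suc k) t \<noteq> 0})"
    by (rule negligible_Union) (auto intro: negligible_zeros_of_nonzero_deriv g)
  ultimately have "negligible {t. g 0 t = 0}"
    by (rule negligible_subset[rotated])
  then show ?thesis by (simp add: g_def matpow_0)
qed

section \<open>Reachable sets and extremal points\<close>

lemma admissible_measurable: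
  assumes "admissible t u"
  shows "(\<lambda>s. u s $ j) \<in> borel_measurable (lebesgue_on {0..t})"
proof -
  have "u \<in> borel_measurable (lebesgue_on {0..t})"
    using assms by (simp add: admissible_def measurable_on_iff_borel_measurable)
  then have "(\<lambda>s. u s \<bullet> axis j 1) \<in> borel_measurable (lebesgue_on {0..t})"
    by simp
  then show ?thesis by (simp add: inner_axis)
qed

lemma admissible_abs_le: "admissible t u \<Longrightarrow> s \<in> {0..t} \<Longrightarrow> \<bar>u s $ j\<bar> \<le> 1"
  by (auto simp: admissible_def ctrl_set_def)

lemma admissible_integrable:
  fixes f :: "real \<Rightarrow> 'a::euclidean_space"
  assumes u: "admissible t u" and f: "continuous_on UNIV f"
  shows "(\<lambda>s. u s $ j *\<^sub>R f s) integrable_on {0..t}"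
proof (rule measurable_bounded_by_integrable_imp_integrable)
  have fc: "continuous_on {0..t} f" using f continuous_on_subset by blast
  then have "f \<in> borel_measurable (lebesgue_on {0..t})"
    by (intro continuous_imp_measurable_on_sets_lebesgue) auto
  then show "(\<lambda>s. u s $ j *\<^sub>R f s) \<in> borel_measurable (lebesgue_on {0..t})"
    using admissible_measurable[OF u] by simp
  show "(\<lambda>s. norm (f s)) integrable_on {0..t}"
    using fc by (intro integrable_continuous_real continuous_intros)
  show "norm (u s $ j *\<^sub>R f s) \<le> norm (f s)" if "s \<in> {0..t}" for s
    using admissible_abs_le[OF u that, of j] by (simp add: mult_left_le_one_le)
qed auto

text \<open>These are the bang-bang controls with switching functions \<open>g j\<close>.\<close>

lemma admissible_sgn:
  fixes g :: "'m::finite \<Rightarrow> real \<Rightarrow> real"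
  assumes "\<And>j. continuous_on UNIV (g j)"
  shows "admissible t (\<lambda>s. \<chi> j. sgn (g j s))"
proof -
  have "(\<lambda>s. sgn (g j s)) \<in> borel_measurable (lebesgue_on {0..t})" for j
  proof -
    have g: "g j \<in> borel_measurable (lebesgue_on {0..t})"
      by (intro continuous_imp_measurable_on_sets_lebesgue continuous_on_subset[OF assms]) auto
    have "(\<lambda>s. if g j s > 0 then 1 else if g j s < 0 then - 1 else (0::real))
        \<in> borel_measurable (lebesgue_on {0..t})"
      using g by measurable
    moreover have "(\<lambda>s. sgn (g j s)) = (\<lambda>s. if g j s > 0 then 1 else if g j s < 0 then - 1 else 0)"
      by (auto simp: sgn_if)
    ultimately show ?thesis by simp
  qed
  then have "(\<lambda>s. \<chi> j. sgn (g j s)) \<in> borel_measurable (lebesgue_on {0..t})"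
    by (subst borel_measurable_euclidean_space) (auto simp: Basis_vec_def inner_axis)
  then show ?thesis
    by (auto simp: admissible_def measurable_on_iff_borel_measurable ctrl_set_def sgn_if)
qed

text \<open>Since \<open>\<tau>\<close> is arbitrary, this serves both for prolonging a control by
  \<open>0\<close> and for restricting it to a shorter interval.\<close>

lemma admissible_extend:
  assumes "admissible t u"
  shows "admissible \<tau> (\<lambda>s. if s \<in> {0..t} then u s else 0)"
proof -
  have "(\<lambda>s. if s \<in> {0..t} then u s else 0) measurable_on UNIV"
    using assms unfolding admissible_def measurable_on_UNIV by simp
  from measurable_on_restrict[OF this, of "{0..\<tau>}"]
  have "(\<lambda>s. if s \<in> {0..t} then u s else 0) measurable_on {0..\<tau>}"
    unfolding measurable_on_UNIV by simp
  then show ?thesis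
    using assms by (auto simp: admissible_def ctrl_set_def)
qed

lemma admissible_convex:
  assumes "admissible t u" "admissible t v" "0 \<le> a" "0 \<le> b" "a + b = 1"
  shows "admissible t (\<lambda>s. a *\<^sub>R u s + b *\<^sub>R v s)"
  unfolding admissible_def
proof (intro conjI ballI)
  show "(\<lambda>s. a *\<^sub>R u s + b *\<^sub>R v s) measurable_on {0..t}"
    using assms by (intro measurable_on_add measurable_on_scaleR_const) (auto simp: admissible_def)
  fix s assume s: "s \<in> {0..t}"
  have "\<bar>a * u s $ j + b * v s $ j\<bar> \<le> 1" for j
  proof -
    have "\<bar>a * u s $ j + b * v s $ j\<bar> \<le> \<bar>a * u s $ j\<bar> + \<bar>b * v s $ j\<bar>"
      by (rule abs_triangle_ineq)
    also have "\<dots> \<le> a * 1 + b * 1"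
      unfolding abs_mult
      using assms admissible_abs_le[OF assms(1) s, of j] admissible_abs_le[OF assms(2) s, of j]
      by (intro add_mono mult_mono) auto
    finally show ?thesis using assms by simp
  qed
  then show "a *\<^sub>R u s + b *\<^sub>R v s \<in> ctrl_set"
    by (simp add: ctrl_set_def)
qed

lemma admissible_uminus: "admissible t u \<Longrightarrow> admissible t (\<lambda>s. - u s)"
  using measurable_on_minus[of u "{0..t}"] by (auto simp: admissible_def ctrl_set_def)

text \<open>The deviation times \<open>\<bar>g\<bar>\<close> equals the loss
  \<open>\<bar>g\<bar> - v * g\<close>, so the loss controls the deviation where \<open>g\<close> is
  large. The second summand pays for small \<open>g\<close>, where only the trivial bound
  \<open>2\<close> is available.\<close>

lemma abs_sgn_diff_le:
  fixes g v \<epsilon> :: real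
  assumes "\<bar>v\<bar> \<le> 1" "0 < \<epsilon>"
  shows "\<bar>sgn g - v\<bar> \<le> (\<bar>g\<bar> - v * g) / \<epsilon> + 2 * \<epsilon> / (\<bar>g\<bar> + \<epsilon>)"
proof -
  have w: "\<bar>sgn g - v\<bar> * \<bar>g\<bar> = \<bar>g\<bar> - v * g"
    using assms(1) by (cases g "0::real" rule: linorder_cases) (auto simp: abs_if algebra_simps)
  then have w0: "0 \<le> \<bar>g\<bar> - v * g"
    by (metis abs_ge_zero mult_nonneg_nonneg)
  have "\<bar>sgn g - v\<bar> \<le> 2"
    using assms(1) by (auto simp: sgn_if)
  with assms(2) have "\<bar>sgn g - v\<bar> * (\<bar>g\<bar> + \<epsilon>) \<le> (\<bar>g\<bar> - v * g) + 2 * \<epsilon>"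
    by (simp add: distrib_left w)
  then have "\<bar>sgn g - v\<bar> \<le> (\<bar>g\<bar> - v * g) / (\<bar>g\<bar> + \<epsilon>) + 2 * \<epsilon> / (\<bar>g\<bar> + \<epsilon>)"
    using assms(2) by (simp add: pos_le_divide_eq add_divide_distrib[symmetric])
  also have "(\<bar>g\<bar> - v * g) / (\<bar>g\<bar> + \<epsilon>) \<le> (\<bar>g\<bar> - v * g) / \<epsilon>"
    using assms(2) w0 by (intro divide_left_mono) auto
  finally show ?thesis by simp
qed

section \<open>Reachable sets and support functions for abstract control directions\<close>

text \<open>Isolates the two properties of the control system on which the geometry of reachable
  sets rests. The second one expresses the rank condition and is the source of strict
  convexity.\<close>

locale linear_reach =
  fixes e :: "'m::finite \<Rightarrow> real \<Rightarrow> real^'n"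
  assumes cont_e: "\<And>j. continuous_on UNIV (e j)"
    and negligible_zeros: "\<And>\<eta> j. \<eta> \<noteq> 0 \<Longrightarrow> negligible {s. \<eta> \<bullet> e j s = 0}"
begin

definition reach :: "real \<Rightarrow> (real^'n) set" where
  "reach t = {integral {0..t} (\<lambda>s. \<Sum>j\<in>UNIV. u s $ j *\<^sub>R e j s) | u. admissible t u}"

definition speed :: "real^'n \<Rightarrow> real \<Rightarrow> real" where
  "speed \<eta> s = (\<Sum>j\<in>UNIV. \<bar>\<eta> \<bullet> e j s\<bar>)"

definition support :: "real^'n \<Rightarrow> real \<Rightarrow> real" where
  "support \<eta> t = integral {0..t} (speed \<eta>)"

definition extremal :: "real^'n \<Rightarrow> real \<Rightarrow> real^'n" where
  "extremal \<eta> t = integral {0..t} (\<lambda>s. \<Sum>j\<in>UNIV. sgn (\<eta> \<bullet> e j s) *\<^sub>R e j s)"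

definition reach_time :: "real^'n \<Rightarrow> ereal" where
  "reach_time x = Inf (ereal ` {t. 0 \<le> t \<and> x \<in> reach t})"

lemma reachI: "admissible t u \<Longrightarrow> integral {0..t} (\<lambda>s. \<Sum>j\<in>UNIV. u s $ j *\<^sub>R e j s) \<in> reach t"
  unfolding reach_def by blast

lemma continuous_on_speed: "continuous_on S (speed \<eta>)"
proof -
  have "continuous_on UNIV (\<lambda>s. \<Sum>j\<in>UNIV. \<bar>\<eta> \<bullet> e j s\<bar>)"
    using cont_e by (intro continuous_intros)
  then show ?thesis
    unfolding speed_def[abs_def] by (rule continuous_on_subset) simp
qed

lemma speed_nonneg: "0 \<le> speed \<eta> s"
  unfolding speed_def by (intro sum_nonneg) auto

lemma speed_eq_0_iff: "speed \<eta> s = 0 \<longleftrightarrow> (\<forall>j. \<eta> \<bullet> e j s = 0)"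
  unfolding speed_def by (subst sum_nonneg_eq_0_iff) auto

text \<open>Bounds the integrand of every controlled integral on \<open>[0, C]\<close>, hence the
  effect of changing the final time.\<close>

lemma e_bound: obtains K where "0 \<le> K" "\<And>s. s \<in> {0..C} \<Longrightarrow> (\<Sum>j\<in>UNIV. norm (e j s)) \<le> K"
proof -
  have "continuous_on UNIV (\<lambda>s. \<Sum>j\<in>UNIV. norm (e j s))"
    using cont_e by (intro continuous_intros)
  then have "compact ((\<lambda>s. \<Sum>j\<in>UNIV. norm (e j s)) ` {0..C})"
    by (intro compact_continuous_image) (auto intro: continuous_on_subset)
  then obtain K where K: "0 < K" "\<forall>x\<in>(\<lambda>s. \<Sum>j\<in>UNIV. norm (e j s)) ` {0..C}. norm x \<le> K"
    using bounded_pos compact_imp_bounded by blast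
  have "(\<Sum>j\<in>UNIV. norm (e j s)) \<le> K" if "s \<in> {0..C}" for s
    using bspec[OF K(2) imageI[OF that]] by (simp add: abs_le_iff)
  with K(1) show ?thesis by (intro that[of K]) auto
qed

lemma integrable_control:
  "admissible t u \<Longrightarrow> (\<lambda>s. \<Sum>j\<in>UNIV. u s $ j *\<^sub>R e j s) integrable_on {0..t}"
  by (intro integrable_sum admissible_integrable cont_e) auto

lemma integrable_inner_control:
  assumes "admissible t u"
  shows "(\<lambda>s. u s $ j * (\<eta> \<bullet> e j s)) integrable_on {0..t}"
  using admissible_integrable[OF assms, of "\<lambda>s. \<eta> \<bullet> e j s" j] cont_e
  by (simp add: continuous_intros)

lemma inner_reach:
  assumes "admissible t u"
  shows "\<eta> \<bullet> integral {0..t} (\<lambda>s. \<Sum>j\<in>UNIV. u s $ j *\<^sub>R e j s)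
    = integral {0..t} (\<lambda>s. \<Sum>j\<in>UNIV. u s $ j * (\<eta> \<bullet> e j s))"
  using integral_linear[OF integrable_control[OF assms] bounded_linear_inner_right[of \<eta>]]
  by (simp add: o_def inner_sum_right)

lemma support_ge:
  assumes "z \<in> reach t"
  shows "\<eta> \<bullet> z \<le> support \<eta> t"
proof -
  from assms obtain u where u: "admissible t u"
    and z: "z = integral {0..t} (\<lambda>s. \<Sum>j\<in>UNIV. u s $ j *\<^sub>R e j s)"
    by (auto simp: reach_def)
  have "integral {0..t} (\<lambda>s. \<Sum>j\<in>UNIV. u s $ j * (\<eta> \<bullet> e j s)) \<le> integral {0..t} (speed \<eta>)"
  proof (rule integral_le)
    show "(\<lambda>s. \<Sum>j\<in>UNIV. u s $ j * (\<eta> \<bullet> e j s)) integrable_on {0..t}"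
      by (intro integrable_sum integrable_inner_control u) auto
    show "speed \<eta> integrable_on {0..t}"
      by (intro integrable_continuous_real continuous_on_speed)
    fix s assume s: "s \<in> {0..t}"
    have "u s $ j * (\<eta> \<bullet> e j s) \<le> \<bar>\<eta> \<bullet> e j s\<bar>" for j
    proof -
      have "u s $ j * (\<eta> \<bullet> e j s) \<le> \<bar>u s $ j\<bar> * \<bar>\<eta> \<bullet> e j s\<bar>"
        by (metis abs_ge_self abs_mult)
      also have "\<dots> \<le> \<bar>\<eta> \<bullet> e j s\<bar>"
        using admissible_abs_le[OF u s, of j] by (simp add: mult_left_le_one_le)
      finally show ?thesis .
    qed
    then show "(\<Sum>j\<in>UNIV. u s $ j * (\<eta> \<bullet> e j s)) \<le> speed \<eta> s"
      unfolding speed_def by (rule sum_mono)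
  qed
  then show ?thesis
    unfolding z support_def inner_reach[OF u] .
qed

lemma admissible_extremal: "admissible t (\<lambda>s. \<chi> j. sgn (\<eta> \<bullet> e j s))"
  using cont_e by (intro admissible_sgn continuous_intros)

lemma extremal_in_reach: "extremal \<eta> t \<in> reach t"
  using reachI[OF admissible_extremal[of t \<eta>]] by (simp add: extremal_def)

text \<open>Together with \<open>support_ge\<close> this identifies \<open>support \<eta> t\<close>
  as the support function of \<open>reach t\<close>, attained at
  \<open>extremal \<eta> t\<close>.\<close>

lemma inner_extremal: "\<eta> \<bullet> extremal \<eta> t = support \<eta> t"
  using inner_reach[OF admissible_extremal[of t \<eta>], of \<eta>]
  by (simp add: extremal_def support_def speed_def[abs_def] abs_sgn mult.commute)

lemma extremal_scaleR: "0 < c \<Longrightarrow> extremal (c *\<^sub>R \<eta>) t = extremal \<eta> t"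
  by (simp add: extremal_def sgn_mult)

text \<open>A control prolonged by \<open>0\<close> adds nothing to the integral: having arrived
  early, the system rests at the origin.\<close>

lemma reach_mono:
  assumes "0 \<le> t" "t \<le> \<tau>"
  shows "reach t \<subseteq> reach \<tau>"
proof
  fix z assume "z \<in> reach t"
  then obtain u where u: "admissible t u"
    and z: "z = integral {0..t} (\<lambda>s. \<Sum>j\<in>UNIV. u s $ j *\<^sub>R e j s)"
    by (auto simp: reach_def)
  define v where "v s = (if s \<in> {0..t} then u s else 0)" for s
  have v: "admissible \<tau> v"
    unfolding v_def by (rule admissible_extend[OF u])
  have "integral {0..\<tau>} (\<lambda>s. \<Sum>j\<in>UNIV. v s $ j *\<^sub>R e j s)
      = integral {0..\<tau>} (\<lambda>s. if s \<in> {0..t} then \<Sum>j\<in>UNIV. u s $ j *\<^sub>R e j s else 0)"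
    by (intro integral_cong) (auto simp: v_def)
  also have "\<dots> = z"
    using assms unfolding z integral_restrict_Int by (simp add: Int_absorb1)
  finally show "z \<in> reach \<tau>"
    using v unfolding reach_def by blast
qed

text \<open>The same control is used up to \<open>\<tau>\<close>; the discarded integral over
  \<open>[\<tau>, t]\<close> is at most \<open>K\<close> times its length.\<close>

lemma reach_truncate:
  assumes "z \<in> reach t" "0 \<le> \<tau>" "\<tau> \<le> t" and K: "\<And>s. s \<in> {0..t} \<Longrightarrow> (\<Sum>j\<in>UNIV. norm (e j s)) \<le> K"
  obtains z' where "z' \<in> reach \<tau>" "norm (z - z') \<le> K * (t - \<tau>)"
proof -
  from assms obtain u where u: "admissible t u"
    and z: "z = integral {0..t} (\<lambda>s. \<Sum>j\<in>UNIV. u s $ j *\<^sub>R e j s)"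
    by (auto simp: reach_def)
  define z' where "z' = integral {0..\<tau>} (\<lambda>s. \<Sum>j\<in>UNIV. u s $ j *\<^sub>R e j s)"
  have "admissible \<tau> u"
  proof -
    have "u measurable_on {0..\<tau>}"
      using admissible_extend[OF u, of \<tau>] \<open>\<tau> \<le> t\<close> unfolding admissible_def
      by (auto elim!: measurable_on_spike[of _ _ "{}"])
    then show ?thesis
      using u \<open>\<tau> \<le> t\<close> by (auto simp: admissible_def)
  qed
  then have "z' \<in> reach \<tau>" unfolding reach_def z'_def by blast
  moreover have "norm (z - z') \<le> K * (t - \<tau>)"
  proof -
    have "z' + integral {\<tau>..t} (\<lambda>s. \<Sum>j\<in>UNIV. u s $ j *\<^sub>R e j s) = z"
      unfolding z z'_def using assms(2,3) integrable_control[OF u] by (intro Henstock_Kurzweil_Integration.integral_combine)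
    then have zz: "z - z' = integral {\<tau>..t} (\<lambda>s. \<Sum>j\<in>UNIV. u s $ j *\<^sub>R e j s)"
      by (simp add: algebra_simps)
    have "norm (integral {\<tau>..t} (\<lambda>s. \<Sum>j\<in>UNIV. u s $ j *\<^sub>R e j s)) \<le> integral {\<tau>..t} (\<lambda>s. K)"
    proof (rule Henstock_Kurzweil_Integration.integral_norm_bound_integral)
      show "(\<lambda>s. \<Sum>j\<in>UNIV. u s $ j *\<^sub>R e j s) integrable_on {\<tau>..t}"
        using integrable_control[OF u] by (rule integrable_subinterval_real) (use assms in auto)
      fix s assume s: "s \<in> {\<tau>..t}"
      then have s': "s \<in> {0..t}" using assms(2) by auto
      have "norm (\<Sum>j\<in>UNIV. u s $ j *\<^sub>R e j s) \<le> (\<Sum>j\<in>UNIV. norm (e j s))"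
        by (intro sum_norm_le) (use admissible_abs_le[OF u s'] in \<open>simp add: mult_left_le_one_le\<close>)
      also have "\<dots> \<le> K" using K s' by blast
      finally show "norm (\<Sum>j\<in>UNIV. u s $ j *\<^sub>R e j s) \<le> K" .
    qed auto
    then show ?thesis using assms(3) by (simp add: zz mult.commute)
  qed
  ultimately show ?thesis by (rule that)
qed

lemma convex_reach: "convex (reach t)"
proof (rule convexI)
  fix x y and a b :: real assume "x \<in> reach t" "y \<in> reach t" and ab: "0 \<le> a" "0 \<le> b" "a + b = 1"
  then obtain u v where u: "admissible t u" and v: "admissible t v"
    and x: "x = integral {0..t} (\<lambda>s. \<Sum>j\<in>UNIV. u s $ j *\<^sub>R e j s)"
    and y: "y = integral {0..t} (\<lambda>s. \<Sum>j\<in>UNIV. v s $ j *\<^sub>R e j s)"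
    by (auto simp: reach_def)
  have "a *\<^sub>R x + b *\<^sub>R y = integral {0..t}
      (\<lambda>s. a *\<^sub>R (\<Sum>j\<in>UNIV. u s $ j *\<^sub>R e j s) + b *\<^sub>R (\<Sum>j\<in>UNIV. v s $ j *\<^sub>R e j s))"
    unfolding x y using integrable_control[OF u] integrable_control[OF v]
    by (subst Henstock_Kurzweil_Integration.integral_add) (auto intro: integrable_cmul)
  also have "\<dots> = integral {0..t} (\<lambda>s. \<Sum>j\<in>UNIV. (a *\<^sub>R u s + b *\<^sub>R v s) $ j *\<^sub>R e j s)"
    by (simp add: scaleR_sum_right sum.distrib algebra_simps)
  finally show "a *\<^sub>R x + b *\<^sub>R y \<in> reach t"
    using reachI[OF admissible_convex[OF u v ab]] by simp
qed

section \<open>The support function: growth in time and continuity\<close>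

lemma support_diff:
  assumes "0 \<le> s" "s \<le> t"
  shows "support \<eta> t - support \<eta> s = integral {s..t} (speed \<eta>)"
  unfolding support_def
  using Henstock_Kurzweil_Integration.integral_combine[of 0 s t "speed \<eta>"] assms
  by (simp add: integrable_continuous_real continuous_on_speed algebra_simps)

lemma support_mono: "0 \<le> s \<Longrightarrow> s \<le> t \<Longrightarrow> support \<eta> s \<le> support \<eta> t"
  using support_diff[of s t \<eta>]
    Henstock_Kurzweil_Integration.integral_nonneg[of "speed \<eta>" "{s..t}"]
  by (simp add: integrable_continuous_real continuous_on_speed speed_nonneg)

text \<open>Equality would force the continuous nonnegative \<open>speed \<eta>\<close> to vanish on
  a whole interval, whereas its zeros are negligible.\<close>

lemma support_strict_mono:
  assumes "0 \<le> s" "s < t" "\<eta> \<noteq> 0"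
  shows "support \<eta> s < support \<eta> t"
proof (rule ccontr)
  assume "\<not> ?thesis"
  with support_mono[of s t \<eta>] support_diff[of s t \<eta>] assms
  have "integral {s..t} (speed \<eta>) = 0" by simp
  then have "\<forall>r\<in>{s..t}. speed \<eta> r = 0"
    using assms by (subst (asm) integral_eq_0_iff) (auto simp: continuous_on_speed speed_nonneg)
  \<comment> \<open>Any column index would do here; \<open>undefined\<close> merely names
    one.\<close>
  then have "{s..t} \<subseteq> {r. \<eta> \<bullet> e undefined r = 0}"
    by (auto simp: speed_eq_0_iff)
  then have "negligible {s..t}"
    using negligible_zeros[OF assms(3)] negligible_subset by blast
  then show False using assms(2) by (simp add: negligible_interval(1)[of s t, unfolded cbox_interval] box_real)
qed

text \<open>The speed is Lipschitz in the direction, uniformly on \<open>[0, C]\<close>, which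
  handles the change of \<open>\<eta>\<close>; the change of time is continuity of an indefinite
  integral.\<close>

lemma support_tendsto:
  assumes \<eta>: "\<eta>s \<longlonglongrightarrow> \<eta>" and ts: "ts \<longlonglongrightarrow> t" and C: "\<And>n. ts n \<in> {0..C}"
  shows "(\<lambda>n. support (\<eta>s n) (ts n)) \<longlonglongrightarrow> support \<eta> t"
proof -
  obtain K where K: "0 \<le> K" "\<And>s. s \<in> {0..C} \<Longrightarrow> (\<Sum>j\<in>UNIV. norm (e j s)) \<le> K"
    using e_bound[of C] by blast
  have t: "t \<in> {0..C}"
    by (rule closed_sequentially[OF closed_atLeastAtMost _ ts]) (use C in blast)
  have "(\<lambda>n. support (\<eta>s n) (ts n) - support \<eta> (ts n)) \<longlonglongrightarrow> 0"
  proof (rule Lim_null_comparison)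
    have "(\<lambda>n. norm (\<eta>s n - \<eta>) * K * C) \<longlonglongrightarrow> norm (\<eta> - \<eta>) * K * C"
      by (intro tendsto_intros \<eta>)
    then show "(\<lambda>n. norm (\<eta>s n - \<eta>) * K * C) \<longlonglongrightarrow> 0" by simp
    show "\<forall>\<^sub>F n in sequentially. norm (support (\<eta>s n) (ts n) - support \<eta> (ts n)) \<le> norm (\<eta>s n - \<eta>) * K * C"
    proof (intro always_eventually allI)
      fix n
      have "support (\<eta>s n) (ts n) - support \<eta> (ts n)
          = integral {0..ts n} (\<lambda>s. speed (\<eta>s n) s - speed \<eta> s)"
        unfolding support_def
        by (intro Henstock_Kurzweil_Integration.integral_diff[symmetric]
            integrable_continuous_real continuous_on_speed)
      also have "norm \<dots> \<le> norm (\<eta>s n - \<eta>) * K * (ts n - 0)"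
      proof (rule integral_bound)
        fix s assume "s \<in> {0..ts n}"
        then have s: "s \<in> {0..C}" using C[of n] by auto
        have "\<bar>speed (\<eta>s n) s - speed \<eta> s\<bar> \<le> (\<Sum>j\<in>UNIV. \<bar>\<bar>\<eta>s n \<bullet> e j s\<bar> - \<bar>\<eta> \<bullet> e j s\<bar>\<bar>)"
          unfolding speed_def sum_subtractf[symmetric] by (rule sum_abs)
        also have "\<dots> \<le> (\<Sum>j\<in>UNIV. norm (\<eta>s n - \<eta>) * norm (e j s))"
        proof (rule sum_mono)
          fix j
          have "\<bar>\<bar>\<eta>s n \<bullet> e j s\<bar> - \<bar>\<eta> \<bullet> e j s\<bar>\<bar> \<le> \<bar>(\<eta>s n - \<eta>) \<bullet> e j s\<bar>"
            by (simp add: inner_diff_left)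
          also have "\<dots> \<le> norm (\<eta>s n - \<eta>) * norm (e j s)"
            by (rule Cauchy_Schwarz_ineq2)
          finally show "\<bar>\<bar>\<eta>s n \<bullet> e j s\<bar> - \<bar>\<eta> \<bullet> e j s\<bar>\<bar> \<le> norm (\<eta>s n - \<eta>) * norm (e j s)" .
        qed
        also have "\<dots> \<le> norm (\<eta>s n - \<eta>) * K"
          unfolding sum_distrib_left[symmetric] by (intro mult_left_mono K s) simp
        finally show "norm (speed (\<eta>s n) s - speed \<eta> s) \<le> norm (\<eta>s n - \<eta>) * K" by simp
      qed (use C[of n] in \<open>auto intro!: continuous_intros continuous_on_speed\<close>)
      also have "\<dots> \<le> norm (\<eta>s n - \<eta>) * K * C"
        using C[of n] K by (intro mult_left_mono) auto
      finally show "norm (support (\<eta>s n) (ts n) - support \<eta> (ts n)) \<le> norm (\<eta>s n - \<eta>) * K * C" .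
    qed
  qed
  moreover have "(\<lambda>n. support \<eta> (ts n)) \<longlonglongrightarrow> support \<eta> t"
  proof (rule continuous_on_tendsto_compose[OF _ ts t])
    show "continuous_on {0..C} (support \<eta>)"
      unfolding support_def[abs_def]
      by (intro indefinite_integral_continuous_1 integrable_continuous_real continuous_on_speed)
  qed (use C in auto)
  ultimately have "(\<lambda>n. (support (\<eta>s n) (ts n) - support \<eta> (ts n)) + support \<eta> (ts n)) \<longlonglongrightarrow> 0 + support \<eta> t"
    by (rule tendsto_add)
  then show ?thesis by simp
qed

lemma speed_tendsto:
  assumes "\<eta>s \<longlonglongrightarrow> \<eta>" "ts \<longlonglongrightarrow> t"
  shows "(\<lambda>n. speed (\<eta>s n) (ts n)) \<longlonglongrightarrow> speed \<eta> t"
proof -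
  have "(\<lambda>n. e j (ts n)) \<longlonglongrightarrow> e j t" for j
    using continuous_on_tendsto_compose[OF cont_e assms(2)] by simp
  then show ?thesis unfolding speed_def by (intro tendsto_intros assms)
qed

text \<open>Weak separation from a convex set, with the normal scaled to length one. Testing it at
  \<open>extremal \<eta> t\<close> turns the separating bound into the support function.\<close>

lemma separating_direction:
  assumes "y \<notin> reach t"
  obtains \<eta> where "norm \<eta> = 1" "support \<eta> t \<le> \<eta> \<bullet> y"
proof -
  have "\<exists>a b. a \<noteq> 0 \<and> (\<forall>x\<in>reach t. a \<bullet> x \<le> b) \<and> (\<forall>x\<in>{y}. b \<le> a \<bullet> x)"
    using assms extremal_in_reach[of 0 t]
    by (intro separating_hyperplane_sets convex_reach) auto
  then obtain a b where a: "a \<noteq> 0" "\<And>x. x \<in> reach t \<Longrightarrow> a \<bullet> x \<le> b" "b \<le> a \<bullet> y" by auto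
  define \<eta> where "\<eta> = (1 / norm a) *\<^sub>R a"
  have "a \<bullet> extremal \<eta> t \<le> a \<bullet> y"
    using a(2)[OF extremal_in_reach] a(3) by (rule order_trans)
  then have "\<eta> \<bullet> extremal \<eta> t \<le> \<eta> \<bullet> y"
    unfolding \<eta>_def inner_scaleR_left by (rule mult_left_mono) simp
  then show ?thesis
    using a(1) by (intro that[of \<eta>]) (auto simp: inner_extremal \<eta>_def)
qed

section \<open>Strict convexity of the reachable sets\<close>

text \<open>These are the error terms of \<open>abs_sgn_diff_le\<close> for
  \<open>\<epsilon> = 1 / (k + 1)\<close>. Each is at most \<open>2\<close> and tends to
  \<open>0\<close> off the zeros of its switching function, so dominated convergence
  applies.\<close>

lemma near_zero_integral_tendsto:
  assumes "\<eta> \<noteq> 0"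
  shows "(\<lambda>k. integral {0..\<tau>} (\<lambda>s. \<Sum>j\<in>UNIV. 2 * inverse (real (Suc k)) / (\<bar>\<eta> \<bullet> e j s\<bar> + inverse (real (Suc k))))) \<longlonglongrightarrow> 0"
proof -
  let ?f = "\<lambda>k s. \<Sum>j\<in>UNIV. 2 * inverse (real (Suc k)) / (\<bar>\<eta> \<bullet> e j s\<bar> + inverse (real (Suc k)))"
  let ?g = "\<lambda>s. \<Sum>j\<in>UNIV. if \<eta> \<bullet> e j s = 0 then 2 else (0::real)"
  have "(\<lambda>k. integral {0..\<tau>} (?f k)) \<longlonglongrightarrow> integral {0..\<tau>} ?g"
  proof (rule dominated_convergence(2))
    fix k
    have "continuous_on {0..\<tau>} (e j)" for j
      using cont_e continuous_on_subset by blast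
    then show "?f k integrable_on {0..\<tau>}"
      by (intro integrable_continuous_real continuous_intros)
        (auto simp: add_nonneg_pos less_imp_neq[symmetric] simp del: of_nat_Suc)
    fix s
    show "norm (?f k s) \<le> (\<Sum>j\<in>(UNIV::'m set). 2)"
    proof (rule sum_norm_le)
      fix j
      define \<epsilon> where "\<epsilon> = inverse (real (Suc k))"
      have "0 < \<epsilon>" by (simp add: \<epsilon>_def)
      then have "norm (2 * \<epsilon> / (\<bar>\<eta> \<bullet> e j s\<bar> + \<epsilon>)) \<le> 2"
        by (simp add: pos_divide_le_eq add_nonneg_pos)
      then show "norm (2 * inverse (real (Suc k)) / (\<bar>\<eta> \<bullet> e j s\<bar> + inverse (real (Suc k)))) \<le> 2"
        by (simp add: \<epsilon>_def)
    qed
  next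
    fix s
    show "(\<lambda>k. ?f k s) \<longlonglongrightarrow> ?g s"
    proof (rule tendsto_sum)
      fix j
      show "(\<lambda>k. 2 * inverse (real (Suc k)) / (\<bar>\<eta> \<bullet> e j s\<bar> + inverse (real (Suc k))))
        \<longlonglongrightarrow> (if \<eta> \<bullet> e j s = 0 then 2 else 0)"
      proof (cases "\<eta> \<bullet> e j s = 0")
        case False
        have "(\<lambda>k. 2 * inverse (real (Suc k)) / (\<bar>\<eta> \<bullet> e j s\<bar> + inverse (real (Suc k))))
          \<longlonglongrightarrow> 2 * 0 / (\<bar>\<eta> \<bullet> e j s\<bar> + 0)"
          by (intro tendsto_intros LIMSEQ_inverse_real_of_nat) (use False in auto)
        with False show ?thesis by simp
      qed (simp del: of_nat_Suc)
    qed
  qed auto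
  moreover have "integral {0..\<tau>} ?g = integral {0..\<tau>} (\<lambda>s. 0::real)"
  proof (rule integral_spike)
    show "negligible (\<Union>j. {s. \<eta> \<bullet> e j s = 0})"
      by (rule negligible_Union) (auto intro: negligible_zeros[OF assms])
  qed auto
  ultimately show ?thesis by simp
qed

text \<open>Strict convexity of the reachable set in the form of stability of maximizers. It replaces weak
  compactness of the set of controls: nowhere below is it needed that the reachable set is closed.\<close>

lemma near_maximizers_tendsto:
  assumes "\<eta> \<noteq> 0" and z: "\<And>n. z n \<in> reach \<tau>"
    and lim: "(\<lambda>n. \<eta> \<bullet> z n) \<longlonglongrightarrow> support \<eta> \<tau>"
  shows "z \<longlonglongrightarrow> extremal \<eta> \<tau>"
proof -
  let ?g = "\<lambda>j s. \<eta> \<bullet> e j s"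
  define D where "D \<epsilon> = integral {0..\<tau>} (\<lambda>s. \<Sum>j\<in>UNIV. 2 * \<epsilon> / (\<bar>?g j s\<bar> + \<epsilon>))" for \<epsilon>
  obtain K where K: "0 \<le> K" "\<And>s. s \<in> {0..\<tau>} \<Longrightarrow> (\<Sum>j\<in>UNIV. norm (e j s)) \<le> K"
    using e_bound[of \<tau>] by blast
  \<comment> \<open>Integrating \<open>abs_sgn_diff_le\<close> bounds the distance by the deficit of
    \<open>z n\<close> in direction \<open>\<eta>\<close>, divided by \<open>\<epsilon>\<close>,
    plus an error \<open>D \<epsilon>\<close> that does not depend on \<open>n\<close>.\<close>
  have est: "norm (z n - extremal \<eta> \<tau>) \<le> K * ((support \<eta> \<tau> - \<eta> \<bullet> z n) / \<epsilon> + D \<epsilon>)"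
    if \<epsilon>: "0 < \<epsilon>" for n \<epsilon>
  proof -
    from z obtain u where u: "admissible \<tau> u"
      and zu: "z n = integral {0..\<tau>} (\<lambda>s. \<Sum>j\<in>UNIV. u s $ j *\<^sub>R e j s)"
      unfolding reach_def by blast
    note ext = admissible_extremal[of \<tau> \<eta>]
    let ?W = "\<lambda>s. \<Sum>j\<in>UNIV. \<bar>?g j s\<bar> - u s $ j * ?g j s"
    let ?E = "\<lambda>s. \<Sum>j\<in>UNIV. 2 * \<epsilon> / (\<bar>?g j s\<bar> + \<epsilon>)"
    have int_u: "(\<lambda>s. \<Sum>j\<in>UNIV. u s $ j * ?g j s) integrable_on {0..\<tau>}"
      by (intro integrable_sum integrable_inner_control u) auto
    have int_s: "speed \<eta> integrable_on {0..\<tau>}"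
      by (intro integrable_continuous_real continuous_on_speed)
    have W_eq: "?W = (\<lambda>s. speed \<eta> s - (\<Sum>j\<in>UNIV. u s $ j * ?g j s))"
      by (simp add: speed_def sum_subtractf)
    have int_W: "?W integrable_on {0..\<tau>}"
      unfolding W_eq by (intro integrable_diff int_u int_s)
    have int_W': "(\<lambda>s. ?W s / \<epsilon>) integrable_on {0..\<tau>}"
      using integrable_on_cmult_right[OF int_W, of "inverse \<epsilon>"] by (simp add: divide_inverse)
    have W: "integral {0..\<tau>} ?W = support \<eta> \<tau> - \<eta> \<bullet> z n"
      unfolding W_eq zu inner_reach[OF u] support_def
      by (intro Henstock_Kurzweil_Integration.integral_diff int_u int_s)
    have ec: "continuous_on {0..\<tau>} (e j)" for j
      using cont_e continuous_on_subset by blast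
    have int_E: "?E integrable_on {0..\<tau>}"
      using ec \<epsilon> by (intro integrable_continuous_real continuous_intros)
        (auto simp: add_nonneg_pos less_imp_neq[symmetric])
    have "z n - extremal \<eta> \<tau> = integral {0..\<tau>}
        (\<lambda>s. (\<Sum>j\<in>UNIV. u s $ j *\<^sub>R e j s) - (\<Sum>j\<in>UNIV. sgn (?g j s) *\<^sub>R e j s))"
      unfolding zu extremal_def using integrable_control[OF u] integrable_control[OF ext]
      by (intro Henstock_Kurzweil_Integration.integral_diff[symmetric]) auto
    also have "\<dots> = integral {0..\<tau>} (\<lambda>s. \<Sum>j\<in>UNIV. (u s $ j - sgn (?g j s)) *\<^sub>R e j s)"
      by (simp add: sum_subtractf scaleR_diff_left)
    also have "norm \<dots> \<le> integral {0..\<tau>} (\<lambda>s. K * (?W s / \<epsilon> + ?E s))"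
    proof (rule Henstock_Kurzweil_Integration.integral_norm_bound_integral)
      show "(\<lambda>s. \<Sum>j\<in>UNIV. (u s $ j - sgn (?g j s)) *\<^sub>R e j s) integrable_on {0..\<tau>}"
        using integrable_diff[OF integrable_control[OF u] integrable_control[OF ext]]
        by (simp add: sum_subtractf scaleR_diff_left)
      show "(\<lambda>s. K * (?W s / \<epsilon> + ?E s)) integrable_on {0..\<tau>}"
        using integrable_on_cmult_left[OF integrable_add[OF int_W' int_E], of K] by simp
      fix s assume s: "s \<in> {0..\<tau>}"
      have le: "\<bar>u s $ j - sgn (?g j s)\<bar> \<le> (\<bar>?g j s\<bar> - u s $ j * ?g j s) / \<epsilon> + 2 * \<epsilon> / (\<bar>?g j s\<bar> + \<epsilon>)" for j
        using abs_sgn_diff_le[OF admissible_abs_le[OF u s, of j] \<epsilon>, of "?g j s"]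
        by (simp add: abs_minus_commute)
      have "norm (\<Sum>j\<in>UNIV. (u s $ j - sgn (?g j s)) *\<^sub>R e j s)
          \<le> (\<Sum>j\<in>UNIV. K * ((\<bar>?g j s\<bar> - u s $ j * ?g j s) / \<epsilon> + 2 * \<epsilon> / (\<bar>?g j s\<bar> + \<epsilon>)))"
      proof (rule sum_norm_le)
        fix j
        have "norm (e j s) \<le> K"
          using K(2)[OF s] member_le_sum[of j UNIV "\<lambda>j. norm (e j s)"] by auto
        then show "norm ((u s $ j - sgn (?g j s)) *\<^sub>R e j s)
            \<le> K * ((\<bar>?g j s\<bar> - u s $ j * ?g j s) / \<epsilon> + 2 * \<epsilon> / (\<bar>?g j s\<bar> + \<epsilon>))"
          unfolding norm_scaleR by (subst mult.commute) (intro mult_mono le K, auto)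
      qed
      also have "\<dots> = K * (?W s / \<epsilon> + ?E s)"
        by (simp add: sum_distrib_left[symmetric] sum.distrib sum_divide_distrib)
      finally show "norm (\<Sum>j\<in>UNIV. (u s $ j - sgn (?g j s)) *\<^sub>R e j s) \<le> K * (?W s / \<epsilon> + ?E s)" .
    qed
    also have "\<dots> = K * (integral {0..\<tau>} ?W / \<epsilon> + integral {0..\<tau>} ?E)"
      using Henstock_Kurzweil_Integration.integral_add[OF int_W' int_E] by simp
    finally show ?thesis by (simp add: W D_def)
  qed
  show ?thesis
  proof (rule tendstoI)
    fix \<rho> :: real assume "0 < \<rho>"
    \<comment> \<open>The order of choices matters: \<open>\<epsilon>\<close> first makes the error
      independent of \<open>n\<close> small, and then \<open>n\<close> is taken large to remove the
      deficit.\<close>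
    have "(\<lambda>k. K * D (inverse (real (Suc k)))) \<longlonglongrightarrow> K * 0"
      unfolding D_def by (intro tendsto_intros near_zero_integral_tendsto assms)
    then have "\<forall>\<^sub>F k in sequentially. K * D (inverse (real (Suc k))) < \<rho>"
      using \<open>0 < \<rho>\<close> by (intro order_tendstoD) auto
    then obtain k where k: "K * D (inverse (real (Suc k))) < \<rho>"
      by (auto simp: eventually_sequentially)
    define \<epsilon> where "\<epsilon> = inverse (real (Suc k))"
    have \<epsilon>: "0 < \<epsilon>" by (simp add: \<epsilon>_def)
    have "(\<lambda>n. K * ((support \<eta> \<tau> - \<eta> \<bullet> z n) / \<epsilon> + D \<epsilon>))
        \<longlonglongrightarrow> K * ((support \<eta> \<tau> - support \<eta> \<tau>) / \<epsilon> + D \<epsilon>)"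
      by (intro tendsto_intros lim) (use \<epsilon> in auto)
    then have "\<forall>\<^sub>F n in sequentially. K * ((support \<eta> \<tau> - \<eta> \<bullet> z n) / \<epsilon> + D \<epsilon>) < \<rho>"
      by (rule order_tendstoD) (use k in \<open>simp add: \<epsilon>_def\<close>)
    then show "\<forall>\<^sub>F n in sequentially. dist (z n) (extremal \<eta> \<tau>) < \<rho>"
      by (rule eventually_mono) (use est[OF \<epsilon>] in \<open>auto simp: dist_norm intro: le_less_trans\<close>)
  qed
qed

text \<open>Otherwise points outside \<open>reach c'\<close> converge to \<open>x\<close>, and a
  limit \<open>l\<close> of separating directions gives
  \<open>support l c' \<le> support l c\<close>, against strict growth. This makes the reaching time
  bounded near \<open>x\<close>.\<close>

lemma reach_subset_interior:
  assumes "0 \<le> c" "c < c'"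
  shows "reach c \<subseteq> interior (reach c')"
proof (rule subsetI, rule ccontr)
  fix x assume x: "x \<in> reach c" and "x \<notin> interior (reach c')"
  then have "x \<in> closure (- reach c')"
    by (simp add: closure_complement)
  then obtain y where y: "\<And>n. y n \<notin> reach c'" "y \<longlonglongrightarrow> x"
    unfolding closure_sequential by auto
  have "\<exists>\<eta>. norm \<eta> = 1 \<and> support \<eta> c' \<le> \<eta> \<bullet> y n" for n
    using separating_direction[OF y(1)[of n]] by blast
  then obtain \<eta> where \<eta>: "\<And>n. norm (\<eta> n) = 1" "\<And>n. support (\<eta> n) c' \<le> \<eta> n \<bullet> y n"
    by metis
  have "\<forall>n. \<eta> n \<in> sphere 0 1" using \<eta>(1) by simp
  then obtain l r where l: "l \<in> sphere 0 1" "strict_mono r" "(\<eta> \<circ> r) \<longlonglongrightarrow> l"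
    using compact_sphere[of "0::real^'n" 1, unfolded compact_def] by blast
  have "(\<lambda>n. support ((\<eta> \<circ> r) n) c') \<longlonglongrightarrow> support l c'"
    by (rule support_tendsto[where C = c', OF l(3)]) (use assms in auto)
  moreover have "(\<lambda>n. (\<eta> \<circ> r) n \<bullet> (y \<circ> r) n) \<longlonglongrightarrow> l \<bullet> x"
    by (intro tendsto_intros l LIMSEQ_subseq_LIMSEQ[OF y(2)])
  ultimately have "support l c' \<le> l \<bullet> x"
    by (rule LIMSEQ_le) (use \<eta>(2) in auto)
  also have "\<dots> \<le> support l c" by (rule support_ge[OF x])
  also have "\<dots> < support l c'"
    using l(1) by (intro support_strict_mono assms) auto
  finally show False by simp
qed

section \<open>The reaching time and its non-Lipschitz points\<close>

lemma reach_time_le: "0 \<le> t \<Longrightarrow> x \<in> reach t \<Longrightarrow> reach_time x \<le> ereal t"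
  unfolding reach_time_def by (intro Inf_lower) auto

lemma reach_time_nonneg: "0 \<le> reach_time x"
  unfolding reach_time_def by (intro Inf_greatest) auto

text \<open>The strict inequality supplies an actual reaching time below \<open>t\<close>, which
  monotonicity raises to \<open>t\<close>.\<close>

lemma reach_time_lessD:
  assumes "reach_time x < ereal t"
  shows "0 \<le> t" "x \<in> reach t"
proof -
  from assms obtain s where "0 \<le> s" "x \<in> reach s" "s < t"
    unfolding reach_time_def Inf_less_iff by auto
  with reach_mono[of s t] show "0 \<le> t" "x \<in> reach t" by auto
qed

lemma reach_time_ge:
  assumes "x \<notin> reach t" "0 \<le> t"
  shows "ereal t \<le> reach_time x"
  using assms reach_time_lessD by (meson not_le)

text \<open>Moving from \<open>x\<close> in the direction \<open>\<eta>\<close> costs much time, since the support function in this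
  direction has vanishing derivative at \<open>r\<close>.\<close>

lemma extremal_non_lipschitz:
  assumes "0 < r" "norm \<eta> = 1" and stat: "\<And>j. \<eta> \<bullet> e j r = 0"
  shows "non_lipschitz_at reach_time (extremal \<eta> r)"
proof -
  define x where "x = extremal \<eta> r"
  have "\<exists>\<delta>. 0 < \<delta> \<and> \<delta> \<le> 1 \<and> (\<forall>s\<in>{r..r+\<delta>}. speed \<eta> s \<le> 1 / real (Suc n))" for n
  proof -
    have "isCont (speed \<eta>) r"
      using continuous_on_speed[of UNIV \<eta>] by (simp add: continuous_on_eq_continuous_at)
    then obtain d where d: "0 < d" "\<And>s. dist s r < d \<Longrightarrow> dist (speed \<eta> s) (speed \<eta> r) < 1 / real (Suc n)"
      unfolding continuous_at_eps_delta by (metis of_nat_0_less_iff zero_less_Suc zero_less_divide_1_iff)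
    have "speed \<eta> r = 0" using stat by (simp add: speed_eq_0_iff)
    have "speed \<eta> s \<le> 1 / real (Suc n)" if "s \<in> {r..r + min 1 (d / 2)}" for s
    proof -
      have "dist s r < d" using that d(1) by (auto simp: dist_real_def)
      from d(2)[OF this] show ?thesis
        using \<open>speed \<eta> r = 0\<close> by (simp add: dist_real_def abs_less_iff)
    qed
    with d(1) show ?thesis
      by (intro exI[of _ "min 1 (d / 2)"]) auto
  qed
  then obtain \<delta> where \<delta>: "\<And>n. 0 < \<delta> n" "\<And>n. \<delta> n \<le> 1"
    "\<And>n s. s \<in> {r..r + \<delta> n} \<Longrightarrow> speed \<eta> s \<le> 1 / real (Suc n)"
    by metis
  \<comment> \<open>The support function grows by at most \<open>\<delta> n / (n + 1)\<close> up to
    time \<open>r + \<delta> n\<close>. Twice that amount puts \<open>y n\<close> out of reach,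
    while \<open>\<delta> n / d n = (n + 1) / 2\<close> still tends to infinity.\<close>
  define d where "d n = 2 * \<delta> n / real (Suc n)" for n
  define y where "y n = x + d n *\<^sub>R \<eta>" for n
  have d0: "0 < d n" for n using \<delta>(1) by (simp add: d_def)
  have norm_y: "norm (y n - x) = d n" for n
    using assms(2) d0[of n] by (simp add: y_def)
  have ge: "ereal (r + \<delta> n) \<le> reach_time (y n)" for n
  proof (rule reach_time_ge)
    have "integral {r..r + \<delta> n} (speed \<eta>) \<le> norm (integral {r..r + \<delta> n} (speed \<eta>))"
      by simp
    also have "\<dots> \<le> 1 / real (Suc n) * (r + \<delta> n - r)"
    proof (rule integral_bound)
      show "norm (speed \<eta> s) \<le> 1 / real (Suc n)" if "s \<in> {r..r + \<delta> n}" for s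
        using \<delta>(3)[OF that] speed_nonneg[of \<eta> s] by simp
    qed (use \<delta>(1)[of n] in \<open>auto intro: continuous_on_speed\<close>)
    also have "\<dots> < d n" using \<delta>(1)[of n] by (simp add: d_def divide_strict_right_mono)
    finally have "support \<eta> (r + \<delta> n) < support \<eta> r + d n"
      using support_diff[of r "r + \<delta> n" \<eta>] assms(1) \<delta>(1)[of n] by simp
    also have "\<dots> = \<eta> \<bullet> y n"
      using assms(2) by (simp add: y_def x_def inner_add_right inner_extremal dot_square_norm)
    finally show "y n \<notin> reach (r + \<delta> n)"
      using support_ge[of "y n" "r + \<delta> n" \<eta>] by auto
  qed (use assms \<delta>(1)[of n] in simp)
  have le: "reach_time x \<le> ereal r"
    unfolding x_def by (intro reach_time_le extremal_in_reach) (use assms in simp)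
  then obtain a where a: "reach_time x = ereal a" "a \<le> r"
    using reach_time_nonneg[of x] by (cases "reach_time x") auto
  have quot: "ereal (real (Suc n) / 2) \<le> \<bar>reach_time (y n) - reach_time x\<bar> / ereal (norm (y n - x))" for n
  proof (cases "reach_time (y n)")
    case (real b)
    then have "\<delta> n \<le> \<bar>b - a\<bar>" using ge[of n] a by simp
    then have "\<delta> n / d n \<le> \<bar>b - a\<bar> / d n" using d0[of n] by (intro divide_right_mono) auto
    moreover have "\<delta> n / d n = real (Suc n) / 2"
      using \<delta>(1)[of n] by (simp add: d_def field_simps)
    ultimately show ?thesis using d0[of n] by (simp add: real a norm_y)
  next
    case PInf
    then show ?thesis using d0[of n] by (simp add: a norm_y)
  next
    case MInf
    then show ?thesis using reach_time_nonneg[of "y n"] by simp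
  qed
  have "(\<lambda>n. \<bar>reach_time (y n) - reach_time x\<bar> / ereal (norm (y n - x))) \<longlonglongrightarrow> \<infinity>"
    unfolding tendsto_PInfty
  proof
    fix R :: real
    obtain N :: nat where N: "2 * R < real N" using reals_Archimedean2 by blast
    show "\<forall>\<^sub>F n in sequentially. ereal R < \<bar>reach_time (y n) - reach_time x\<bar> / ereal (norm (y n - x))"
      using eventually_ge_at_top[of N]
    proof (rule eventually_mono)
      fix n assume "N \<le> n"
      with N have "ereal R < ereal (real (Suc n) / 2)" by simp
      with quot[of n] show "ereal R < \<bar>reach_time (y n) - reach_time x\<bar> / ereal (norm (y n - x))"
        by (rule less_le_trans[rotated])
    qed
  qed
  then have "limsup (\<lambda>n. \<bar>reach_time (y n) - reach_time x\<bar> / ereal (norm (y n - x))) = \<infinity>"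
    by (intro lim_imp_Limsup) auto
  moreover have "y \<longlonglongrightarrow> x"
  proof (rule LIM_zero_cancel, rule Lim_null_comparison)
    show "\<forall>\<^sub>F n in sequentially. norm (y n - x) \<le> 2 * inverse (real (Suc n))"
      using \<delta>(2) by (auto simp: norm_y d_def divide_inverse simp del: of_nat_Suc intro!: always_eventually mult_right_mono)
    show "(\<lambda>n. 2 * inverse (real (Suc n))) \<longlonglongrightarrow> 0"
      using tendsto_mult_left[OF LIMSEQ_inverse_real_of_nat, of 2] by simp
  qed
  moreover have "x \<noteq> y n" for n using norm_y[of n] d0[of n] by auto
  ultimately show ?thesis
    unfolding non_lipschitz_at_def x_def[symmetric]
    by (intro exI[of _ "\<lambda>_. x"] exI[of _ y]) auto
qed

section \<open>From unbounded difference quotients to an extremal point\<close>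

text \<open>The slack in the strict inequality is cut into thirds \<open>g\<close>: one raises
  \<open>p\<close> so that \<open>a\<close> is reached, one lowers \<open>q\<close> so that
  \<open>b\<close> is not, and the last keeps \<open>s < t\<close>.\<close>

lemma reach_time_gap:
  assumes "reach_time a = ereal p" "reach_time b = ereal q" "k * norm (b - a) < q - p" "0 \<le> k" "q \<le> C"
  obtains s t where "a \<in> reach s" "b \<notin> reach t" "0 \<le> s" "s < t" "t \<le> C" "k * norm (b - a) \<le> t - s"
proof -
  obtain g where g: "0 < g" "q - p = k * norm (b - a) + 3 * g"
  proof
    show "0 < (q - p - k * norm (b - a)) / 3" using assms(3) by simp
    show "q - p = k * norm (b - a) + 3 * ((q - p - k * norm (b - a)) / 3)" by (simp add: field_simps)
  qed
  have p: "0 \<le> p" using reach_time_nonneg[of a] assms(1) by simp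
  have kn: "0 \<le> k * norm (b - a)" using assms(4) by simp
  show ?thesis
  proof (rule that[of "p + g" "q - g"])
    show "a \<in> reach (p + g)" using reach_time_lessD(2)[of a "p + g"] assms(1) g by simp
    show "b \<notin> reach (q - g)"
    proof
      assume "b \<in> reach (q - g)"
      then have "reach_time b \<le> ereal (q - g)"
        by (rule reach_time_le[rotated]) (use g p kn in linarith)
      with assms(2) g show False by simp
    qed
  qed (use g p kn assms(5) in linarith)+
qed

text \<open>A minimum point of the continuous speed works, since the minimum is at most the
  mean.\<close>

lemma speed_le_average:
  assumes "0 \<le> s" "s < t"
  obtains \<sigma> where "\<sigma> \<in> {s..t}" "speed \<eta> \<sigma> * (t - s) \<le> support \<eta> t - support \<eta> s"
proof -
  obtain \<sigma> where \<sigma>: "\<sigma> \<in> {s..t}" "\<And>r. r \<in> {s..t} \<Longrightarrow> speed \<eta> \<sigma> \<le> speed \<eta> r"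
    using continuous_attains_inf[of "{s..t}" "speed \<eta>"] assms by (force simp: continuous_on_speed)
  have "integral {s..t} (\<lambda>_. speed \<eta> \<sigma>) \<le> integral {s..t} (speed \<eta>)"
    by (intro integral_le \<sigma> integrable_continuous_real continuous_on_speed) auto
  then show ?thesis
    using assms \<sigma>(1) by (intro that[of \<sigma>]) (auto simp: support_diff mult.commute)
qed

text \<open>As \<open>x\<close> is interior to \<open>reach (c + 1)\<close>, nearby reaching times
  are finite, and an infinite limsup yields pairs with a large quotient in any ball around
  \<open>x\<close>. Of the two points, \<open>a\<close> is the one with the smaller time.\<close>

lemma non_lipschitz_pairs:
  assumes "non_lipschitz_at reach_time x" and c: "0 \<le> c" "x \<in> reach c"
  shows "\<exists>a b s t. dist a x < inverse (real (Suc k)) \<and> dist b x < inverse (real (Suc k)) \<and> a \<in> reach s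
    \<and> b \<notin> reach t \<and> 0 \<le> s \<and> s < t \<and> t \<le> c + 1 \<and> real (Suc k) * norm (b - a) \<le> t - s"
proof -
  obtain xs ys where lim: "xs \<longlonglongrightarrow> x" "ys \<longlonglongrightarrow> x" and neq: "\<And>n. xs n \<noteq> ys n"
    and limsup: "limsup (\<lambda>n. \<bar>reach_time (ys n) - reach_time (xs n)\<bar> / ereal (norm (ys n - xs n))) = \<infinity>"
    using assms(1) unfolding non_lipschitz_at_def by blast
  let ?q = "\<lambda>n. \<bar>reach_time (ys n) - reach_time (xs n)\<bar> / ereal (norm (ys n - xs n))"
  define U where "U = interior (reach (c + 1)) \<inter> ball x (inverse (real (Suc k)))"
  have "open U" "x \<in> U"
    using reach_subset_interior[of c "c + 1"] c by (auto simp: U_def)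
  then have ev: "\<forall>\<^sub>F n in sequentially. xs n \<in> U \<and> ys n \<in> U"
    using lim by (intro eventually_conj topological_tendstoD)
  have "\<exists>n. xs n \<in> U \<and> ys n \<in> U \<and> ereal (real (Suc k)) < ?q n"
  proof (rule ccontr)
    assume "\<not> ?thesis"
    with ev have "\<forall>\<^sub>F n in sequentially. ?q n \<le> ereal (real (Suc k))"
      by (elim eventually_mono) (meson not_le)
    then have "limsup ?q \<le> ereal (real (Suc k))" by (rule Limsup_bounded)
    with limsup show False by simp
  qed
  then obtain n where n: "xs n \<in> U" "ys n \<in> U" "ereal (real (Suc k)) < ?q n" by blast
  have fin: "\<exists>p. reach_time z = ereal p \<and> p \<le> c + 1" if "z \<in> U" for z
  proof -
    have "z \<in> reach (c + 1)" using that interior_subset by (auto simp: U_def)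
    then have "reach_time z \<le> ereal (c + 1)" using c by (intro reach_time_le) auto
    with reach_time_nonneg[of z] show ?thesis by (cases "reach_time z") auto
  qed
  obtain p q where pq: "reach_time (xs n) = ereal p" "p \<le> c + 1" "reach_time (ys n) = ereal q" "q \<le> c + 1"
    using fin n by metis
  have d: "norm (ys n - xs n) \<noteq> 0" using neq[of n] by auto
  then have "real (Suc k) < \<bar>q - p\<bar> / norm (ys n - xs n)"
    using n(3) pq by simp
  then have gap: "real (Suc k) * norm (ys n - xs n) < \<bar>q - p\<bar>"
    using d by (subst (asm) pos_less_divide_eq) auto
  have near: "dist z x < inverse (real (Suc k))" if "z \<in> U" for z
    using that by (simp add: U_def dist_commute)
  show ?thesis
  proof (cases "p \<le> q")
    case True
    then have "real (Suc k) * norm (ys n - xs n) < q - p" using gap by simp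
    from reach_time_gap[OF pq(1,3) this _ pq(4)] show ?thesis
      using near[OF n(1)] near[OF n(2)] by (metis of_nat_0_le_iff)
  next
    case False
    then have "real (Suc k) * norm (xs n - ys n) < p - q" using gap by (simp add: norm_minus_commute)
    from reach_time_gap[OF pq(3,1) this _ pq(2)] show ?thesis
      using near[OF n(1)] near[OF n(2)] by (metis of_nat_0_le_iff)
  qed
qed

lemma reach_near:
  assumes "z \<in> reach t" "t \<in> {0..C}" "\<tau> \<in> {0..C}" and K: "0 \<le> K" "\<And>s. s \<in> {0..C} \<Longrightarrow> (\<Sum>j\<in>UNIV. norm (e j s)) \<le> K"
  shows "\<exists>z'\<in>reach \<tau>. norm (z - z') \<le> K * \<bar>t - \<tau>\<bar>"
proof (cases "t \<le> \<tau>")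
  case True
  with assms reach_mono[of t \<tau>] show ?thesis by (intro bexI[of _ z]) auto
next
  case False
  then obtain z' where "z' \<in> reach \<tau>" "norm (z - z') \<le> K * (t - \<tau>)"
    using reach_truncate[of z t \<tau> K] assms by auto
  with False show ?thesis by auto
qed

text \<open>If \<open>T b - T a\<close> is large compared with \<open>\<bar>b - a\<bar>\<close>, then a direction separating \<open>b\<close> from the reachable
  set makes the support function grow slowly somewhere between the times \<open>T a\<close> and \<open>T b\<close>. A limit of
  such directions and times exhibits \<open>x\<close> as an extremal point.\<close>

lemma non_lipschitz_extremal:
  assumes nl: "non_lipschitz_at reach_time x" and fin: "reach_time x < \<infinity>" and "x \<noteq> 0"
  obtains r \<eta> where "0 < r" "norm \<eta> = 1" "x = extremal \<eta> r" "\<And>j. \<eta> \<bullet> e j r = 0"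
proof -
  obtain c where "reach_time x < ereal c"
    using ereal_dense2[OF fin] by blast
  then have c: "0 \<le> c" "x \<in> reach c" by (auto dest: reach_time_lessD)
  define C where "C = c + 1"
  define Q where "Q k a b s t \<longleftrightarrow> dist a x < inverse (real (Suc k)) \<and> dist b x < inverse (real (Suc k))
    \<and> a \<in> reach s \<and> b \<notin> reach t \<and> 0 \<le> s \<and> s < t \<and> t \<le> C \<and> real (Suc k) * norm (b - a) \<le> t - s"
    for k a b s t
  have "\<exists>a b s t. Q k a b s t" for k
    unfolding Q_def C_def by (rule non_lipschitz_pairs[OF nl c])
  then obtain a b s t where Q: "\<And>k. Q k (a k) (b k) (s k) (t k)"
    by metis
  have a: "dist (a k) x < inverse (real (Suc k))" and b: "dist (b k) x < inverse (real (Suc k))"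
    and as: "a k \<in> reach (s k)" and bt: "b k \<notin> reach (t k)"
    and st: "0 \<le> s k" "s k < t k" "t k \<le> C"
    and gap: "real (Suc k) * norm (b k - a k) \<le> t k - s k" for k
    using Q[of k] unfolding Q_def by blast+
  have "\<exists>\<eta>. norm \<eta> = 1 \<and> support \<eta> (t k) \<le> \<eta> \<bullet> b k" for k
    using separating_direction[OF bt[of k]] by blast
  then obtain \<eta> where \<eta>: "\<And>k. norm (\<eta> k) = 1" "\<And>k. support (\<eta> k) (t k) \<le> \<eta> k \<bullet> b k"
    by metis
  have "\<exists>\<sigma>. \<sigma> \<in> {s k..t k} \<and> speed (\<eta> k) \<sigma> * (t k - s k) \<le> support (\<eta> k) (t k) - support (\<eta> k) (s k)" for k
    using speed_le_average[OF st(1,2)[of k]] by blast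
  then obtain \<sigma> where \<sigma>: "\<And>k. \<sigma> k \<in> {s k..t k}"
    "\<And>k. speed (\<eta> k) (\<sigma> k) * (t k - s k) \<le> support (\<eta> k) (t k) - support (\<eta> k) (s k)"
    by metis
  \<comment> \<open>Separation and the average bound give \<open>speed * (k + 1) * \<bar>b - a\<bar>
    \<le> \<eta> \<bullet> (b - a) \<le> \<bar>b - a\<bar>\<close>, and
    \<open>b k \<noteq> a k\<close> allows division.\<close>
  have slow: "speed (\<eta> k) (\<sigma> k) \<le> inverse (real (Suc k))" for k
  proof -
    have "b k \<noteq> a k" using as[of k] bt[of k] reach_mono[of "s k" "t k"] st[of k] by auto
    then have d: "0 < norm (b k - a k)" by simp
    have "speed (\<eta> k) (\<sigma> k) * (real (Suc k) * norm (b k - a k)) \<le> speed (\<eta> k) (\<sigma> k) * (t k - s k)"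
      by (intro mult_left_mono gap speed_nonneg)
    also have "\<dots> \<le> \<eta> k \<bullet> b k - \<eta> k \<bullet> a k"
      using \<sigma>(2)[of k] \<eta>(2)[of k] support_ge[OF as[of k], of "\<eta> k"] by linarith
    also have "\<dots> \<le> norm (b k - a k)"
      using norm_cauchy_schwarz[of "\<eta> k" "b k - a k"] \<eta>(1)[of k] by (simp add: inner_diff_right)
    finally have "(speed (\<eta> k) (\<sigma> k) * real (Suc k)) * norm (b k - a k) \<le> 1 * norm (b k - a k)"
      by (simp add: mult.assoc)
    then have "speed (\<eta> k) (\<sigma> k) * real (Suc k) \<le> 1"
      using d by (rule mult_right_le_imp_le)
    then show ?thesis by (simp add: field_simps)
  qed
  have cmp: "compact (sphere (0::real^'n) 1 \<times> {0..C} \<times> {0..C} \<times> {0..C})"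
    by (intro compact_Times) auto
  have mem: "\<forall>k. (\<eta> k, s k, t k, \<sigma> k) \<in> sphere 0 1 \<times> {0..C} \<times> {0..C} \<times> {0..C}"
  proof
    fix k show "(\<eta> k, s k, t k, \<sigma> k) \<in> sphere 0 1 \<times> {0..C} \<times> {0..C} \<times> {0..C}"
      using \<eta>(1)[of k] st[of k] \<sigma>(1)[of k] by auto
  qed
  obtain l r where l: "l \<in> sphere 0 1 \<times> {0..C} \<times> {0..C} \<times> {0..C}"
    and r: "strict_mono r" and conv: "((\<lambda>k. (\<eta> k, s k, t k, \<sigma> k)) \<circ> r) \<longlonglongrightarrow> l"
    by (rule seq_compactE[OF compact_imp_seq_compact[OF cmp] mem])
  obtain \<eta>' s' t' \<sigma>' where l_eq: "l = (\<eta>', s', t', \<sigma>')" by (cases l) auto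
  have \<eta>': "norm \<eta>' = 1" and s': "s' \<in> {0..C}" using l by (auto simp: l_eq)
  have \<eta>_lim: "(\<lambda>k. \<eta> (r k)) \<longlonglongrightarrow> \<eta>'"
    using tendsto_fst[OF conv] by (simp add: l_eq o_def)
  have s_lim: "(\<lambda>k. s (r k)) \<longlonglongrightarrow> s'"
    using tendsto_fst[OF tendsto_snd[OF conv]] by (simp add: l_eq o_def)
  have t_lim: "(\<lambda>k. t (r k)) \<longlonglongrightarrow> t'"
    using tendsto_fst[OF tendsto_snd[OF tendsto_snd[OF conv]]] by (simp add: l_eq o_def)
  have \<sigma>_lim: "(\<lambda>k. \<sigma> (r k)) \<longlonglongrightarrow> \<sigma>'"
    using tendsto_snd[OF tendsto_snd[OF tendsto_snd[OF conv]]] by (simp add: l_eq o_def)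
  have "a \<longlonglongrightarrow> x"
    by (rule tendsto_dist_iff[THEN iffD2],
        rule tendsto_sandwich[OF _ _ tendsto_const LIMSEQ_inverse_real_of_nat])
      (use a in \<open>auto intro!: always_eventually less_imp_le simp del: of_nat_Suc\<close>)
  have "b \<longlonglongrightarrow> x"
    by (rule tendsto_dist_iff[THEN iffD2],
        rule tendsto_sandwich[OF _ _ tendsto_const LIMSEQ_inverse_real_of_nat])
      (use b in \<open>auto intro!: always_eventually less_imp_le simp del: of_nat_Suc\<close>)
  have inv_r: "inverse (real (Suc (r k))) \<le> inverse (real (Suc k))" for k
    using seq_suble[OF r, of k] by (intro le_imp_inverse_le) auto
  have a_lim: "(\<lambda>k. a (r k)) \<longlonglongrightarrow> x"
    using LIMSEQ_subseq_LIMSEQ[OF \<open>a \<longlonglongrightarrow> x\<close> r] by (simp add: o_def)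
  have b_lim: "(\<lambda>k. b (r k)) \<longlonglongrightarrow> x"
    using LIMSEQ_subseq_LIMSEQ[OF \<open>b \<longlonglongrightarrow> x\<close> r] by (simp add: o_def)
  have "speed \<eta>' \<sigma>' \<le> 0"
    by (rule LIMSEQ_le[OF speed_tendsto[OF \<eta>_lim \<sigma>_lim] LIMSEQ_inverse_real_of_nat])
      (use slow inv_r order_trans in blast)
  then have stat: "\<eta>' \<bullet> e j \<sigma>' = 0" for j
    using speed_nonneg[of \<eta>' \<sigma>'] speed_eq_0_iff[of \<eta>' \<sigma>'] by auto
  have upper: "support \<eta>' t' \<le> \<eta>' \<bullet> x"
  proof (rule LIMSEQ_le)
    show "(\<lambda>k. support (\<eta> (r k)) (t (r k))) \<longlonglongrightarrow> support \<eta>' t'"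
      using st less_imp_le order_trans
      by (intro support_tendsto[where C = C] \<eta>_lim t_lim) (simp, blast)
    show "(\<lambda>k. \<eta> (r k) \<bullet> b (r k)) \<longlonglongrightarrow> \<eta>' \<bullet> x"
      by (intro tendsto_intros \<eta>_lim b_lim)
  qed (use \<eta>(2) in auto)
  have lower: "\<eta>' \<bullet> x \<le> support \<eta>' s'"
  proof (rule LIMSEQ_le)
    show "(\<lambda>k. support (\<eta> (r k)) (s (r k))) \<longlonglongrightarrow> support \<eta>' s'"
      using st less_imp_le order_trans
      by (intro support_tendsto[where C = C] \<eta>_lim s_lim) (simp, blast)
    show "(\<lambda>k. \<eta> (r k) \<bullet> a (r k)) \<longlonglongrightarrow> \<eta>' \<bullet> x"
      by (intro tendsto_intros \<eta>_lim a_lim)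
  qed (use support_ge[OF as] in auto)
  have "s' \<le> \<sigma>'" "\<sigma>' \<le> t'"
    using LIMSEQ_le[OF s_lim \<sigma>_lim] LIMSEQ_le[OF \<sigma>_lim t_lim] \<sigma>(1) by auto
  \<comment> \<open>The value of \<open>\<eta>'\<close> at \<open>x\<close> lies above the support
    function at \<open>t'\<close> and below it at \<open>s'\<close>, so strict growth collapses the
    limiting interval, and \<open>\<sigma>'\<close> with it.\<close>
  moreover have "\<not> s' < t'"
    using support_strict_mono[of s' t' \<eta>'] upper lower s' \<eta>' by fastforce
  ultimately have eq: "\<sigma>' = s'" "t' = s'" by auto
  obtain K where K: "0 \<le> K" "\<And>s. s \<in> {0..C} \<Longrightarrow> (\<Sum>j\<in>UNIV. norm (e j s)) \<le> K"
    using e_bound[of C] by blast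
  \<comment> \<open>The points \<open>a (r k)\<close> belong to reachable sets of varying times.
    They are replaced by nearby points of the single set \<open>reach s'\<close>, to which stability
    of maximizers applies.\<close>
  have "\<exists>z\<in>reach s'. norm (a (r k) - z) \<le> K * \<bar>s (r k) - s'\<bar>" for k
    using st(1)[of "r k"] st(2)[of "r k"] st(3)[of "r k"] by (intro reach_near[OF as _ s' K]) auto
  then obtain z where z: "\<And>k. z k \<in> reach s'" "\<And>k. norm (a (r k) - z k) \<le> K * \<bar>s (r k) - s'\<bar>"
    by metis
  have "(\<lambda>k. a (r k) - z k) \<longlonglongrightarrow> 0"
  proof (rule Lim_null_comparison)
    have "(\<lambda>k. K * \<bar>s (r k) - s'\<bar>) \<longlonglongrightarrow> K * \<bar>s' - s'\<bar>"
      by (intro tendsto_intros s_lim)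
    then show "(\<lambda>k. K * \<bar>s (r k) - s'\<bar>) \<longlonglongrightarrow> 0" by simp
  qed (use z(2) in auto)
  from tendsto_diff[OF a_lim this] have z_lim: "z \<longlonglongrightarrow> x" by simp
  have "z \<longlonglongrightarrow> extremal \<eta>' s'"
  proof (rule near_maximizers_tendsto[OF _ z(1)])
    have "\<eta>' \<bullet> x = support \<eta>' s'" using upper lower eq by simp
    then show "(\<lambda>n. \<eta>' \<bullet> z n) \<longlonglongrightarrow> support \<eta>' s'"
      using tendsto_inner[OF tendsto_const z_lim, of \<eta>'] by simp
  qed (use \<eta>' in auto)
  with z_lim have x_eq: "x = extremal \<eta>' s'" by (rule LIMSEQ_unique)
  \<comment> \<open>An integral over a degenerate interval vanishes, so time \<open>0\<close> would
    give \<open>x = 0\<close>.\<close>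
  with \<open>x \<noteq> 0\<close> have "s' \<noteq> 0" by (auto simp: extremal_def)
  with s' have "0 < s'" by simp
  then show ?thesis using that \<eta>' x_eq stat eq by auto
qed

end

section \<open>The minimum time function\<close>

lemma inner_column_eq:
  fixes B :: "real^'m^'n"
  shows "\<zeta> \<bullet> (B *v v) = (\<Sum>j\<in>UNIV. v $ j * (\<zeta> \<bullet> column j B))"
  by (simp add: matrix_mult_sum inner_sum_right scalar_mult_eq_scaleR)

lemma mexp_control_eq:
  fixes B :: "real^'m^'n"
  shows "mexp M *v (B *v v) = (\<Sum>j\<in>UNIV. v $ j *\<^sub>R (mexp M *v column j B))"
  by (simp add: matrix_mult_sum[of B] scalar_mult_eq_scaleR linear_sum[OF matrix_vector_mul_linear]
      matrix_vector_mult_scaleR)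

lemma INF_ctrl_set:
  fixes B :: "real^'m^'n"
  shows "(INF v\<in>ctrl_set. \<zeta> \<bullet> (B *v v)) = - (\<Sum>j\<in>UNIV. \<bar>\<zeta> \<bullet> column j B\<bar>)"
proof (rule cInf_eq_minimum)
  let ?v = "\<chi> j. - sgn (\<zeta> \<bullet> column j B)"
  have "?v \<in> ctrl_set" by (simp add: ctrl_set_def abs_sgn_eq)
  moreover have "\<zeta> \<bullet> (B *v ?v) = - (\<Sum>j\<in>UNIV. \<bar>\<zeta> \<bullet> column j B\<bar>)"
    by (simp add: inner_column_eq abs_sgn mult.commute sum_negf)
  ultimately show "- (\<Sum>j\<in>UNIV. \<bar>\<zeta> \<bullet> column j B\<bar>) \<in> (\<lambda>v. \<zeta> \<bullet> (B *v v)) ` ctrl_set"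
    by (metis image_eqI)
  fix x assume "x \<in> (\<lambda>v. \<zeta> \<bullet> (B *v v)) ` ctrl_set"
  then obtain v where v: "v \<in> ctrl_set" and x: "x = \<zeta> \<bullet> (B *v v)" by auto
  have "- \<bar>\<zeta> \<bullet> column j B\<bar> \<le> v $ j * (\<zeta> \<bullet> column j B)" for j
  proof -
    have "\<bar>v $ j * (\<zeta> \<bullet> column j B)\<bar> \<le> \<bar>\<zeta> \<bullet> column j B\<bar>"
      using v by (auto simp: ctrl_set_def abs_mult mult_left_le_one_le)
    then show ?thesis by linarith
  qed
  then show "- (\<Sum>j\<in>UNIV. \<bar>\<zeta> \<bullet> column j B\<bar>) \<le> x"
    unfolding x inner_column_eq sum_negf[symmetric] by (rule sum_mono)
qed

text \<open>Subtracting the minimal value leaves a vanishing sum of nonnegative terms, so each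
  coordinate is minimizing on its own.\<close>

lemma minimizing_control_eq:
  fixes B :: "real^'m^'n"
  assumes "v \<in> ctrl_set" "\<zeta> \<bullet> (B *v v) = (INF v\<in>ctrl_set. \<zeta> \<bullet> (B *v v))" "\<zeta> \<bullet> column j B \<noteq> 0"
  shows "v $ j = - sgn (\<zeta> \<bullet> column j B)"
proof -
  have "(\<Sum>j\<in>UNIV. v $ j * (\<zeta> \<bullet> column j B) + \<bar>\<zeta> \<bullet> column j B\<bar>) = 0"
    using assms(2) unfolding INF_ctrl_set by (simp add: inner_column_eq sum.distrib)
  moreover have "0 \<le> v $ j * (\<zeta> \<bullet> column j B) + \<bar>\<zeta> \<bullet> column j B\<bar>" for j
  proof -
    have "\<bar>v $ j * (\<zeta> \<bullet> column j B)\<bar> \<le> \<bar>\<zeta> \<bullet> column j B\<bar>"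
      using assms(1) by (auto simp: ctrl_set_def abs_mult mult_left_le_one_le)
    then show ?thesis by linarith
  qed
  ultimately have "v $ j * (\<zeta> \<bullet> column j B) + \<bar>\<zeta> \<bullet> column j B\<bar> = 0"
    by (subst (asm) sum_nonneg_eq_0_iff) auto
  then have "(v $ j + sgn (\<zeta> \<bullet> column j B)) * (\<zeta> \<bullet> column j B) = 0"
    by (simp add: abs_sgn algebra_simps)
  with assms(3) show ?thesis by simp
qed

lemma integral_reverse:
  fixes f :: "real \<Rightarrow> 'a::banach"
  shows "integral {0..r} (\<lambda>s. f (r - s)) = integral {0..r} f"
proof -
  have "integral {0..r} (\<lambda>s. f (r - s)) = integral {- r..- 0} (\<lambda>s. f (s + r))"
    using Henstock_Kurzweil_Integration.integral_reflect_real[of r 0 "\<lambda>s. f (r - s)"]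
    by (simp add: add.commute)
  also have "\<dots> = integral {0..r} f"
    using integral_shift_real_ivl[of 0 r r f] by simp
  finally show ?thesis .
qed

lemma S_setI:
  assumes "0 < r" "\<zeta> \<noteq> 0" "\<And>i. \<zeta> \<bullet> column i B = 0"
    and "x = (\<Sum>i\<in>UNIV. integral {0..r}
      (\<lambda>t. sgn (\<zeta> \<bullet> (mexp (t *\<^sub>R A) *v column i B)) *\<^sub>R (mexp ((t - r) *\<^sub>R A) *v column i B)))"
  shows "x \<in> S_set A B"
proof -
  let ?\<zeta> = "(1 / norm \<zeta>) *\<^sub>R \<zeta>"
  have "sgn (?\<zeta> \<bullet> w) = sgn (\<zeta> \<bullet> w)" for w
    using assms(2) by (simp add: sgn_mult)
  then show ?thesis
    unfolding S_set_def using assms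
    by (intro CollectI exI[of _ r] exI[of _ ?\<zeta>] conjI) auto
qed

section \<open>Translation between the control system and reachable sets\<close>

text \<open>The effect of control \<open>j\<close> at time \<open>s\<close>, transported back to
  time \<open>0\<close>; hence the minus sign.\<close>

definition flow_column :: "real^'n^'n \<Rightarrow> real^'m^'n \<Rightarrow> 'm \<Rightarrow> real \<Rightarrow> real^'n" where
  "flow_column A B j s = mexp ((- s) *\<^sub>R A) *v column j B"

lemma linear_reach_flow_column:
  fixes A :: "real^'n^'n" and B :: "real^'m^'n"
  assumes "\<forall>i. dim (span {matpow A j *v column i B | j. j < CARD('n)}) = CARD('n)"
  shows "linear_reach (flow_column A B)"
proof
  show "continuous_on UNIV (flow_column A B j)" for j
  proof -
    have "continuous_on UNIV ((\<lambda>t. mexp (t *\<^sub>R A) *v column j B) \<circ> uminus)"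
      by (intro continuous_on_compose continuous_on_mexp continuous_intros)
    then show ?thesis by (simp add: flow_column_def[abs_def] o_def)
  qed
  fix \<eta> :: "real^'n" and j assume "\<eta> \<noteq> 0"
  then have "negligible {t. \<eta> \<bullet> (mexp (t *\<^sub>R A) *v column j B) = 0}"
    using assms by (intro negligible_mexp_zeros) auto
  then have "negligible (uminus ` {t. \<eta> \<bullet> (mexp (t *\<^sub>R A) *v column j B) = 0})"
    by (rule negligible_differentiable_image_negligible[rotated])
      (auto intro!: differentiable_on_minus differentiable_on_ident)
  moreover have "{s. \<eta> \<bullet> flow_column A B j s = 0} = uminus ` {t. \<eta> \<bullet> (mexp (t *\<^sub>R A) *v column j B) = 0}"
    unfolding flow_column_def by (auto simp: image_iff) (metis minus_minus scaleR_minus_left)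
  ultimately show "negligible {s. \<eta> \<bullet> flow_column A B j s = 0}" by simp
qed

text \<open>The final state is the invertible matrix \<open>mexp (\<theta> A)\<close> applied to
  \<open>x\<close> plus the integral.\<close>

lemma traj_eq_0_iff:
  fixes A :: "real^'n^'n" and B :: "real^'m^'n"
  assumes "linear_reach (flow_column A B)" "admissible \<theta> u"
  shows "traj A B x u \<theta> = 0 \<longleftrightarrow> x = - integral {0..\<theta>} (\<lambda>s. \<Sum>j\<in>UNIV. u s $ j *\<^sub>R flow_column A B j s)"
proof -
  interpret linear_reach "flow_column A B" by fact
  let ?I = "integral {0..\<theta>} (\<lambda>s. \<Sum>j\<in>UNIV. u s $ j *\<^sub>R flow_column A B j s)"
  have "mexp ((\<theta> - s) *\<^sub>R A) *v (B *v u s) = mexp (\<theta> *\<^sub>R A) *v (\<Sum>j\<in>UNIV. u s $ j *\<^sub>R flow_column A B j s)" for s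
    using mexp_add[of \<theta> "- s" A "B *v u s"] mexp_control_eq[of "(- s) *\<^sub>R A" B "u s"]
    by (simp add: flow_column_def)
  then have "integral {0..\<theta>} (\<lambda>s. mexp ((\<theta> - s) *\<^sub>R A) *v (B *v u s)) = mexp (\<theta> *\<^sub>R A) *v ?I"
    using integral_linear[OF integrable_control[OF assms(2)] matrix_vector_mul_bounded_linear]
    by (simp add: o_def)
  then have eq: "traj A B x u \<theta> = mexp (\<theta> *\<^sub>R A) *v (x + ?I)"
    by (simp add: traj_def matrix_vector_right_distrib)
  have "mexp (\<theta> *\<^sub>R A) *v w = 0 \<longleftrightarrow> w = 0" for w
    using mexp_uminus_cancel[of "- \<theta>" A w] by (metis matrix_vector_mult_0_right minus_minus)
  then show ?thesis
    unfolding eq by (simp add: add_eq_0_iff2)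
qed

text \<open>The minus sign in \<open>traj_eq_0_iff\<close> is absorbed by the symmetry of the
  control set under negation.\<close>

lemma min_time_eq_reach_time:
  fixes A :: "real^'n^'n" and B :: "real^'m^'n"
  assumes "linear_reach (flow_column A B)"
  shows "min_time A B = linear_reach.reach_time (flow_column A B)"
proof
  interpret linear_reach "flow_column A B" by fact
  fix x
  have "(\<exists>u. admissible \<theta> u \<and> traj A B x u \<theta> = 0) \<longleftrightarrow> x \<in> reach \<theta>" for \<theta>
  proof
    assume "\<exists>u. admissible \<theta> u \<and> traj A B x u \<theta> = 0"
    then obtain u where u: "admissible \<theta> u" "traj A B x u \<theta> = 0" by blast
    then show "x \<in> reach \<theta>"
      using reachI[OF admissible_uminus[OF u(1)]] traj_eq_0_iff[OF assms u(1)] by (simp add: sum_negf)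
  next
    assume "x \<in> reach \<theta>"
    then obtain u where u: "admissible \<theta> u"
      "x = integral {0..\<theta>} (\<lambda>s. \<Sum>j\<in>UNIV. u s $ j *\<^sub>R flow_column A B j s)"
      by (auto simp: reach_def)
    then show "\<exists>u. admissible \<theta> u \<and> traj A B x u \<theta> = 0"
      using admissible_uminus[OF u(1)] traj_eq_0_iff[OF assms admissible_uminus[OF u(1)], of x]
      by (auto simp: sum_negf)
  qed
  then show "min_time A B x = reach_time x"
    by (simp add: min_time_def reach_time_def)
qed

text \<open>The substitution \<open>t = r - s\<close> reverses time, and moving
  \<open>mexp (r A)\<close> onto \<open>\<zeta>\<close> by transposition matches the signs.\<close>

lemma S_set_sum_eq_extremal:
  fixes A :: "real^'n^'n" and B :: "real^'m^'n"
  assumes "linear_reach (flow_column A B)"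
  shows "(\<Sum>i\<in>UNIV. integral {0..r}
      (\<lambda>t. sgn (\<zeta> \<bullet> (mexp (t *\<^sub>R A) *v column i B)) *\<^sub>R (mexp ((t - r) *\<^sub>R A) *v column i B)))
    = linear_reach.extremal (flow_column A B) (transpose (mexp (r *\<^sub>R A)) *v \<zeta>) r"
proof -
  interpret linear_reach "flow_column A B" by fact
  let ?\<eta> = "transpose (mexp (r *\<^sub>R A)) *v \<zeta>"
  have "integral {0..r} (\<lambda>t. sgn (\<zeta> \<bullet> (mexp (t *\<^sub>R A) *v column i B)) *\<^sub>R (mexp ((t - r) *\<^sub>R A) *v column i B))
      = integral {0..r} (\<lambda>s. sgn (?\<eta> \<bullet> flow_column A B i s) *\<^sub>R flow_column A B i s)" for i
  proof (subst integral_reverse[symmetric], rule integral_cong)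
    fix s
    show "sgn (\<zeta> \<bullet> (mexp ((r - s) *\<^sub>R A) *v column i B)) *\<^sub>R (mexp ((r - s - r) *\<^sub>R A) *v column i B)
        = sgn (?\<eta> \<bullet> flow_column A B i s) *\<^sub>R flow_column A B i s"
      using mexp_add[of r "- s" A "column i B"] by (simp add: flow_column_def dot_lmul_matrix)
  qed
  moreover have "(\<lambda>s. sgn (?\<eta> \<bullet> flow_column A B i s) *\<^sub>R flow_column A B i s) integrable_on {0..r}" for i
    using admissible_integrable[OF admissible_extremal[of r ?\<eta>] cont_e, of i i] by simp
  ultimately show ?thesis
    unfolding extremal_def by (simp add: Henstock_Kurzweil_Integration.integral_sum)
qed

text \<open>The transposed flow over time \<open>r\<close> carries \<open>\<zeta>\<close> to
  \<open>\<eta>\<close> up to normalization, and orthogonality to the columns of \<open>B\<close> to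
  orthogonality to their images at time \<open>r\<close>.\<close>

lemma S_set_iff_extremal:
  fixes A :: "real^'n^'n" and B :: "real^'m^'n"
  assumes "linear_reach (flow_column A B)"
  shows "x \<in> S_set A B \<longleftrightarrow> (\<exists>r>0. \<exists>\<eta>. norm \<eta> = 1 \<and> x = linear_reach.extremal (flow_column A B) \<eta> r
    \<and> (\<forall>j. \<eta> \<bullet> flow_column A B j r = 0))"
proof
  interpret linear_reach "flow_column A B" by fact
  assume "x \<in> S_set A B"
  then obtain r \<zeta> where r: "0 < r" and \<zeta>: "norm \<zeta> = 1" "\<And>i. \<zeta> \<bullet> column i B = 0"
    and x: "x = extremal (transpose (mexp (r *\<^sub>R A)) *v \<zeta>) r"
    unfolding S_set_def S_set_sum_eq_extremal[OF assms] by blast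
  define \<eta> where "\<eta> = transpose (mexp (r *\<^sub>R A)) *v \<zeta>"
  have inner: "\<eta> \<bullet> (mexp ((- r) *\<^sub>R A) *v w) = \<zeta> \<bullet> w" for w
    using mexp_uminus_cancel[of r A w] by (simp add: \<eta>_def dot_lmul_matrix)
  have "\<eta> \<noteq> 0" using inner[of \<zeta>] \<zeta>(1) by auto
  then show "\<exists>r>0. \<exists>\<eta>. norm \<eta> = 1 \<and> x = extremal \<eta> r \<and> (\<forall>j. \<eta> \<bullet> flow_column A B j r = 0)"
    using r x[folded \<eta>_def] inner \<zeta>(2)
    by (intro exI[of _ r] conjI exI[of _ "(1 / norm \<eta>) *\<^sub>R \<eta>"])
      (auto simp: extremal_scaleR flow_column_def)
next
  interpret linear_reach "flow_column A B" by fact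
  assume "\<exists>r>0. \<exists>\<eta>. norm \<eta> = 1 \<and> x = extremal \<eta> r \<and> (\<forall>j. \<eta> \<bullet> flow_column A B j r = 0)"
  then obtain r \<eta> where r: "0 < r" and \<eta>: "norm \<eta> = 1" "\<And>j. \<eta> \<bullet> flow_column A B j r = 0"
    and x: "x = extremal \<eta> r" by blast
  define \<zeta> where "\<zeta> = transpose (mexp ((- r) *\<^sub>R A)) *v \<eta>"
  have inner: "\<zeta> \<bullet> w = \<eta> \<bullet> (mexp ((- r) *\<^sub>R A) *v w)" for w
    by (simp add: \<zeta>_def dot_lmul_matrix)
  have "(transpose (mexp (r *\<^sub>R A)) *v \<zeta>) \<bullet> w = \<eta> \<bullet> w" for w
    using mexp_uminus_cancel[of "- r" A w] inner by (simp add: dot_lmul_matrix)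
  then have eq: "transpose (mexp (r *\<^sub>R A)) *v \<zeta> = \<eta>"
    by (metis vector_eq_rdot)
  then have "\<zeta> \<noteq> 0" using \<eta>(1) by auto
  then show "x \<in> S_set A B"
  proof (rule S_setI[OF r])
    show "\<zeta> \<bullet> column i B = 0" for i using \<eta>(2)[of i] by (simp add: inner flow_column_def)
  qed (simp add: S_set_sum_eq_extremal[OF assms] eq x del: transpose_matrix_vector)
qed

section \<open>Invariance under trajectories with vanishing Hamiltonian\<close>

text \<open>The state at time \<open>0\<close> is the origin, so the vanishing Hamiltonian there
  reduces to a vanishing sum of \<open>\<bar>p 0 \<bullet> column j B\<bar>\<close>. The same vector
  \<open>p 0\<close> then serves as \<open>\<zeta>\<close> for every \<open>t\<close>.\<close>

lemma rev_traj_in_S_set: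
  fixes A :: "real^'n^'n" and B :: "real^'m^'n"
  assumes kalman: "\<forall>i. dim (span {matpow A j *v column i B | j. j < CARD('n)}) = CARD('n)"
    and u: "admissible \<theta> u"
    and p: "\<forall>t\<in>{0..\<theta>}. (p has_vector_derivative transpose A *v p t) (at t within {0..\<theta>})"
    and pmp: "negligible {t\<in>{0..\<theta>}. p t \<bullet> (B *v u t) \<noteq> (INF v\<in>ctrl_set. p t \<bullet> (B *v v))}"
    and "p \<theta> \<noteq> 0" and ham: "ham A B (rev_traj A B u 0) (p 0) = 0"
    and t: "t \<in> {0<..\<theta>}"
  shows "rev_traj A B u t \<in> S_set A B"
proof -
  have flow: "p s \<bullet> v = p 0 \<bullet> (mexp (s *\<^sub>R A) *v v)" if "s \<in> {0..\<theta>}" for s v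
    using adjoint_flow[of "{0..\<theta>}" p A 0 s v] p that t by auto
  have "p 0 \<noteq> 0"
    using flow[of \<theta> "p \<theta>"] \<open>p \<theta> \<noteq> 0\<close> t by auto
  have "(\<Sum>j\<in>UNIV. \<bar>p 0 \<bullet> column j B\<bar>) = 0"
    using ham by (simp add: ham_def rev_traj_def INF_ctrl_set)
  then have orth: "p 0 \<bullet> column j B = 0" for j
    by (subst (asm) sum_nonneg_eq_0_iff) auto
  let ?g = "\<lambda>j s. p 0 \<bullet> (mexp (s *\<^sub>R A) *v column j B)"
  let ?f = "\<lambda>j s. sgn (?g j s) *\<^sub>R (mexp ((s - t) *\<^sub>R A) *v column j B)"
  \<comment> \<open>Off this negligible set the minimum condition holds and no switching function
    vanishes, so the control is determined.\<close>
  let ?Z = "{t\<in>{0..\<theta>}. p t \<bullet> (B *v u t) \<noteq> (INF v\<in>ctrl_set. p t \<bullet> (B *v v))} \<union> (\<Union>j. {s. ?g j s = 0})"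
  have "negligible (\<Union>j. {s. ?g j s = 0})"
    using kalman \<open>p 0 \<noteq> 0\<close> by (intro negligible_Union) (auto intro!: negligible_mexp_zeros)
  with pmp have Z: "negligible ?Z" by (rule negligible_Un)
  have int: "integral {0..t} (\<lambda>s. mexp ((s - t) *\<^sub>R A) *v (B *v u s)) = integral {0..t} (\<lambda>s. - (\<Sum>j\<in>UNIV. ?f j s))"
  proof (rule integral_spike[OF Z])
    fix s assume s: "s \<in> {0..t} - ?Z"
    then have s': "s \<in> {0..\<theta>}" using t by auto
    have "u s $ j = - sgn (?g j s)" for j
    proof -
      have "u s $ j = - sgn (p s \<bullet> column j B)"
      proof (rule minimizing_control_eq)
        show "u s \<in> ctrl_set" using u s' by (auto simp: admissible_def)
        show "p s \<bullet> (B *v u s) = (INF v\<in>ctrl_set. p s \<bullet> (B *v v))" using s s' by auto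
        show "p s \<bullet> column j B \<noteq> 0" using s flow[OF s'] by auto
      qed
      then show ?thesis using flow[OF s'] by simp
    qed
    then show "- (\<Sum>j\<in>UNIV. ?f j s) = mexp ((s - t) *\<^sub>R A) *v (B *v u s)"
      by (simp add: mexp_control_eq sum_negf)
  qed
  have "?f j integrable_on {0..t}" for j
  proof -
    have "continuous_on UNIV (\<lambda>s. mexp ((s - t) *\<^sub>R A) *v column j B)"
      by (rule continuous_on_compose[of UNIV "\<lambda>s. s - t", OF _ continuous_on_mexp, unfolded o_def])
        (intro continuous_intros)
    moreover have "admissible t (\<lambda>s. \<chi> j. sgn (?g j s))"
      by (intro admissible_sgn continuous_intros continuous_on_mexp)
    ultimately show ?thesis
      using admissible_integrable[of t "\<lambda>s. \<chi> j. sgn (?g j s)" _ j] by simp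
  qed
  then have "integral {0..t} (\<lambda>s. \<Sum>j\<in>UNIV. ?f j s) = (\<Sum>j\<in>UNIV. integral {0..t} (?f j))"
    by (intro Henstock_Kurzweil_Integration.integral_sum) auto
  \<comment> \<open>The minus sign of the reversed dynamics cancels that of the minimizing
    control.\<close>
  then have "rev_traj A B u t = (\<Sum>j\<in>UNIV. integral {0..t} (?f j))"
    by (simp add: rev_traj_def int)
  then show ?thesis
    using t orth \<open>p 0 \<noteq> 0\<close> by (intro S_setI[of t "p 0"]) auto
qed

text \<open>Finiteness places \<open>xbar\<close> in the controllable region: on an open set of
  infinite minimum time, \<open>\<infinity> - \<infinity> = \<infinity>\<close> would make every
  quotient infinite. The function \<open>p\<close> solves the adjoint equation of the reversed
  dynamics, hence the plus sign before \<open>transpose A\<close>.\<close>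

theorem theorem4p4:
  fixes A :: "real^'n^'n" and B :: "real^'m^'n" and xbar :: "real^'n"
  assumes "CARD('m) \<le> CARD('n)" and "CARD('n) \<ge> 2"
    and "\<forall>i. dim (span {matpow A j *v column i B | j. j < CARD('n)}) = CARD('n)"
    and "rank B < CARD('n)"
    and "xbar \<noteq> 0"
    and "min_time A B xbar < \<infinity>"
  shows "(non_lipschitz_at (min_time A B) xbar \<longleftrightarrow> xbar \<in> S_set A B)
    \<and> (\<forall>\<theta> u p. \<theta> > 0 \<and> admissible \<theta> u \<and> min_time A B (rev_traj A B u \<theta>) = ereal \<theta>
         \<and> (\<forall>t\<in>{0..\<theta>}. (p has_vector_derivative (transpose A *v p t)) (at t within {0..\<theta>}))
         \<and> negligible {t\<in>{0..\<theta>}. p t \<bullet> (B *v u t) \<noteq> (INF v\<in>ctrl_set. p t \<bullet> (B *v v))}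
         \<and> p \<theta> \<noteq> 0 \<and> proximal_normal (reach_set A B \<theta>) (rev_traj A B u \<theta>) (p \<theta>)
         \<and> (\<forall>t\<in>{0..\<theta>}. ham A B (rev_traj A B u t) (p t) = 0)
       \<longrightarrow> (\<forall>t\<in>{0<..\<theta>}. rev_traj A B u t \<in> S_set A B))"
proof (intro conjI allI impI ballI)
  have lr: "linear_reach (flow_column A B)"
    by (rule linear_reach_flow_column[OF assms(3)])
  interpret linear_reach "flow_column A B" by (rule lr)
  show "non_lipschitz_at (min_time A B) xbar \<longleftrightarrow> xbar \<in> S_set A B"
  proof
    assume "non_lipschitz_at (min_time A B) xbar"
    then show "xbar \<in> S_set A B"
      using assms(5,6) non_lipschitz_extremal[of xbar]
      unfolding S_set_iff_extremal[OF lr] min_time_eq_reach_time[OF lr] by metis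
  next
    assume "xbar \<in> S_set A B"
    then show "non_lipschitz_at (min_time A B) xbar"
      using extremal_non_lipschitz
      unfolding S_set_iff_extremal[OF lr] min_time_eq_reach_time[OF lr] by auto
  qed
next
  fix \<theta> u p t
  assume "\<theta> > 0 \<and> admissible \<theta> u \<and> min_time A B (rev_traj A B u \<theta>) = ereal \<theta>
         \<and> (\<forall>t\<in>{0..\<theta>}. (p has_vector_derivative (transpose A *v p t)) (at t within {0..\<theta>}))
         \<and> negligible {t\<in>{0..\<theta>}. p t \<bullet> (B *v u t) \<noteq> (INF v\<in>ctrl_set. p t \<bullet> (B *v v))}
         \<and> p \<theta> \<noteq> 0 \<and> proximal_normal (reach_set A B \<theta>) (rev_traj A B u \<theta>) (p \<theta>)
         \<and> (\<forall>t\<in>{0..\<theta>}. ham A B (rev_traj A B u t) (p t) = 0)"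
    and "t \<in> {0<..\<theta>}"
  then show "rev_traj A B u t \<in> S_set A B"
    by (intro rev_traj_in_S_set[OF assms(3), of \<theta> u p]) auto
qed

end
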